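(* Let $A>2$ and $B\geqslant 3$ be real numbers. Let $n\geqslant 3$ be an integer such that every prime dividing $n$ is at least $B$, and such that $n$ is not a prime power. Let $S\supset\mathbb{Z}/n\mathbb{Z}$ be a cyclic $\mathbb{Z}/n\mathbb{Z}$-algebra of dimension $d$, and let $\sigma$ be a generator of its Galois group $\mathcal{G}$. Assume that $n$ has a prime power divisor $p^v$ (with $p$ prime, $v\geqslant1$) satisfying \[v\log p\geqslant \frac{A\log n}{d}.\] Then the density \[\mu_S=\frac{\#\{x\in S^*\mid \sigma(x)=x^n\}}{\# S^*}\] satisfies \[\mu_S\leqslant p^{-\frac{vd}{2}\left(1-\frac{2}{A}-\frac{4}{B}\right)}\leqslant n^{-\frac{A}{2}\left(1-\frac{2}{A}-\frac{4}{B}\right)}.\]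
   Context: $\log$ is the natural logarithm; $S^*$ is the group of units of $S$. Let $R$ be a commutative ring. A cyclic extension (cyclic $R$-algebra) of $R$ is a commutative $R$-algebra $S$ together with a finite cyclic group $\mathcal{G}$ of $R$-algebra automorphisms of $S$ such that $S$ is a Galois extension of $R$ with group $\mathcal{G}$, i.e. the subring of $\mathcal{G}$-invariants is $S^{\mathcal{G}}=R$ and, for every $\tau\in\mathcal{G}$ with $\tau\neq \mathrm{id}$ and every maximal ideal $\mathfrak{m}$ of $S$, there exists $s\in S$ with $\tau(s)-s\notin\mathfrak{m}$. Such an $S$ (for $R=\mathbb{Z}/n\mathbb{Z}$) is a free $R$-module of rank equal to $\#\mathcal{G}$; this rank $d$ is called its dimension (or degree).
   Formalization: The second inequality (p-power bound ≤ n-power bound) is asserted only when 1−2/A−4/B ≥ 0, as it fails for negative values (e.g. A=B=3, n=15, p=3, v=1, d=10); both upper bounds on μ_S are proved without this restriction. *)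

theory Defs
  imports
    Complex_Main
    "HOL-Algebra.Algebra"
    "HOL-Number_Theory.Number_Theory"
begin

hide_const (open) Divisibility.prime

text \<open>Automorphisms are extensional functions on the carrier, so that their composition and
  identity are those of \<^const>\<open>BijGroup\<close>.\<close>

definition algebra_auts ::
  "('r, 'm) ring_scheme \<Rightarrow> ('r, 's, 'k) module_scheme \<Rightarrow> ('s \<Rightarrow> 's) set" where
  "algebra_auts R S =
     {\<tau> \<in> Bij (carrier S). \<tau> \<in> ring_hom S S \<and>
        (\<forall>r\<in>carrier R. \<forall>x\<in>carrier S. \<tau> (r \<odot>\<^bsub>S\<^esub> x) = r \<odot>\<^bsub>S\<^esub> \<tau> x)}"

definition invariants :: "('s, 'k) ring_scheme \<Rightarrow> ('s \<Rightarrow> 's) set \<Rightarrow> 's set" where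
  "invariants S G = {x \<in> carrier S. \<forall>\<tau>\<in>G. \<tau> x = x}"

text \<open>The invariants being \<open>R\<close> means that the structure map \<open>r \<mapsto> r \<cdot> 1\<close> is a
  bijection from \<open>R\<close> onto them; in particular \<open>R\<close> embeds into \<open>S\<close>.\<close>

definition galois_extension ::
  "('r, 'm) ring_scheme \<Rightarrow> ('r, 's, 'k) module_scheme \<Rightarrow> ('s \<Rightarrow> 's) set \<Rightarrow> bool" where
  "galois_extension R S G \<longleftrightarrow>
     Module.algebra R S \<and>
     subgroup G (BijGroup (carrier S)) \<and> finite G \<and> G \<subseteq> algebra_auts R S \<and>
     bij_betw (\<lambda>r. r \<odot>\<^bsub>S\<^esub> \<one>\<^bsub>S\<^esub>) (carrier R) (invariants S G) \<and>
     (\<forall>\<tau>\<in>G. \<tau> \<noteq> \<one>\<^bsub>BijGroup (carrier S)\<^esub> \<longrightarrow>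
        (\<forall>M. maximalideal M S \<longrightarrow> (\<exists>s\<in>carrier S. \<tau> s \<ominus>\<^bsub>S\<^esub> s \<notin> M)))"

definition cyclic_extension ::
  "('r, 'm) ring_scheme \<Rightarrow> ('r, 's, 'k) module_scheme \<Rightarrow> ('s \<Rightarrow> 's) set \<Rightarrow> bool" where
  "cyclic_extension R S G \<longleftrightarrow>
     galois_extension R S G \<and> cyclic_group ((BijGroup (carrier S))\<lparr>carrier := G\<rparr>)"

definition free_of_rank ::
  "('r, 'm) ring_scheme \<Rightarrow> ('r, 's, 'k) module_scheme \<Rightarrow> nat \<Rightarrow> bool" where
  "free_of_rank R S d \<longleftrightarrow>
     (\<exists>b \<in> {..<d} \<rightarrow> carrier S. \<forall>x\<in>carrier S.
        \<exists>!a. a \<in> {..<d} \<rightarrow>\<^sub>E carrier R \<and> x = (\<Oplus>\<^bsub>S\<^esub>i\<in>{..<d}. a i \<odot>\<^bsub>S\<^esub> b i))"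

definition power_density :: "('s, 'k) ring_scheme \<Rightarrow> ('s \<Rightarrow> 's) \<Rightarrow> nat \<Rightarrow> real" where
  "power_density S \<sigma> n =
     real (card {x \<in> Units S. \<sigma> x = x [^]\<^bsub>S\<^esub> n}) / real (card (Units S))"

end

theory Submission
  imports Defs
begin

text \<open>
  Put \<open>T = S / p ^ v S\<close>. This is again a cyclic algebra, over \<open>\<int> / p ^ v\<close>: the ideals \<open>p ^ v S\<close> and
  \<open>(n / p ^ v) S\<close> are each other's annihilators, so an element fixed modulo \<open>p ^ v\<close> becomes fixed
  when multiplied by \<open>n / p ^ v\<close>. Units of \<open>T\<close> lift to units of \<open>S\<close>, and therefore the density for
  \<open>S\<close> is at most that for \<open>T\<close>. As \<open>T\<close> has at most \<open>d\<close> maximal ideals, all with residue fields of at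
  least \<open>p\<close> elements, it has at least \<open>p ^ (v d) (1 - 1 / p) ^ d\<close> units.

  Let \<open>M\<close> be a maximal ideal of \<open>T\<close> with residue field \<open>k\<close>. A unit \<open>x\<close> with \<open>\<sigma> x = x ^ n\<close> is
  determined by its image in \<open>k\<close>: if \<open>y = x - 1\<close> lies in \<open>M\<close>, the ideal \<open>y T\<close> is \<open>\<sigma>\<close>-stable, hence
  contained in all maximal ideals; so \<open>\<sigma> y = s y\<close> with \<open>s\<close> in the Jacobson radical, whence \<open>y = 0\<close>.
  If \<open>\<sigma> M \<noteq> M\<close>, then \<open>k\<close> has at most \<open>p ^ (d / 2)\<close> elements. Otherwise \<open>\<sigma>\<close> acts on \<open>k\<close> by a power
  \<open>t \<mapsto> t ^ (p ^ a)\<close> of Frobenius, which differs from \<open>t \<mapsto> t ^ n\<close> as \<open>n\<close> is not a prime power. In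
  both cases there are at most \<open>n p ^ (d / 2)\<close> solutions, and \<open>n \<le> p ^ (v d / A)\<close> by assumption.
\<close>

text \<open>The infix \<open>\<cdot>\<close> for ideal products makes the notation \<open>[k] \<cdot> x\<close> for \<open>k\<close>-fold sums ambiguous.\<close>

no_notation ideal_prod (infixl \<open>\<cdot>\<index>\<close> 80)

section \<open>Counting in finite rings\<close>

lemma card_eq_mult_card_fibre:
  assumes "finite A" "finite B" "f ` A \<subseteq> B" and fibre: "\<And>y. y \<in> B \<Longrightarrow> card {x \<in> A. f x = y} = c"
  shows "card A = card B * c"
  using sum.group[OF assms(1-3), of "\<lambda>_. 1::nat"] fibre by simp

lemma (in ideal) minus_closed: "x \<in> I \<Longrightarrow> y \<in> I \<Longrightarrow> x \<ominus> y \<in> I"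
  by (simp add: a_minus_def)

lemma (in ideal) add_mem_iff:
  assumes "x \<in> carrier R" "y \<in> I"
  shows "x \<oplus> y \<in> I \<longleftrightarrow> x \<in> I"
proof
  assume "x \<oplus> y \<in> I"
  then have "(x \<oplus> y) \<ominus> y \<in> I"
    using assms(2) by (rule minus_closed)
  moreover have "(x \<oplus> y) \<ominus> y = x"
    using assms by (simp add: a_minus_def a_assoc r_neg)
  ultimately show "x \<in> I"
    by simp
qed (use assms in simp)

lemma (in maximalideal) one_notin: "\<one> \<notin> I"
  using I_notcarr one_imp_carrier by blast

context cring
begin

lemma quotient_hom: "ideal I R \<Longrightarrow> ring_hom_cring R (R Quot I) ((+>) I)"
  using ideal.rcos_ring_hom_cring is_cring by blast

lemma carrier_quotient: "carrier (R Quot I) = (+>) I ` carrier R"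
  by (auto simp: FactRing_simps)

lemma rcos_eq_iff:
  "\<lbrakk>ideal I R; a \<in> carrier R; b \<in> carrier R\<rbrakk> \<Longrightarrow> I +> a = I +> b \<longleftrightarrow> a \<ominus> b \<in> I"
  by (rule quotient_eq_iff_same_a_r_cos[symmetric])

lemma rcos_eq_zero_iff:
  assumes "ideal I R" "a \<in> carrier R"
  shows "I +> a = \<zero>\<^bsub>R Quot I\<^esub> \<longleftrightarrow> a \<in> I"
  using rcos_eq_iff[OF assms zero_closed] a_rcos_zero[OF assms(1), of \<zero>] assms
  by (simp add: FactRing_def a_minus_def additive_subgroup.zero_closed ideal.axioms(1))

lemma card_quotient:
  assumes "ideal I R"
  shows "card (carrier (R Quot I)) * card I = card (carrier R)"
  using add.lagrange[of I] assms
  by (simp add: FactRing_def A_RCOSETS_def order_def additive_subgroup.a_subgroup ideal.axioms(1))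

lemma finite_carrier_quotient: "finite (carrier R) \<Longrightarrow> finite (carrier (R Quot I))"
  by (simp add: carrier_quotient)

lemma finite_ideal: "finite (carrier R) \<Longrightarrow> ideal I R \<Longrightarrow> finite I"
  by (meson additive_subgroup.a_subset finite_subset ideal.axioms(1))

lemma card_ideal_pos:
  assumes "finite (carrier R)" "ideal I R"
  shows "card I > 0"
  using assms finite_ideal additive_subgroup.zero_closed[OF ideal.axioms(1)]
  by (metis card_gt_0_iff empty_iff)

lemma card_quotient_antimono:
  assumes fin: "finite (carrier R)" and I: "ideal I R" and J: "ideal J R" and "I \<subseteq> J"
  shows "card (carrier (R Quot J)) \<le> card (carrier (R Quot I))"
proof -
  have "card (carrier (R Quot J)) * card I \<le> card (carrier (R Quot J)) * card J"
    using \<open>I \<subseteq> J\<close> finite_ideal[OF fin J] by (simp add: card_mono)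
  also have "\<dots> = card (carrier (R Quot I)) * card I"
    using card_quotient I J by simp
  finally show ?thesis
    using card_ideal_pos[OF fin I] by simp
qed

lemma card_Int_rcos:
  assumes M: "ideal M R" and A: "A \<subseteq> carrier R" and w: "w \<in> carrier R"
    and invariant: "\<And>a. a \<in> A \<Longrightarrow> a \<oplus> w \<in> A" "\<And>a. a \<in> A \<Longrightarrow> a \<ominus> w \<in> A"
  shows "card {a \<in> A. M +> a = M +> w} = card (A \<inter> M)"
proof -
  have "M +> a = M +> w \<longleftrightarrow> a \<ominus> w \<in> M" if "a \<in> A" for a
    using that A w by (intro rcos_eq_iff[OF M]) auto
  then have coset: "{a \<in> A. M +> a = M +> w} = {a \<in> A. a \<ominus> w \<in> M}"
    by blast
  have cancel: "(a \<oplus> w) \<ominus> w = a" "(a \<ominus> w) \<oplus> w = a" if "a \<in> A" for a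
  proof -
    have "a \<in> carrier R"
      using that A by auto
    then show "(a \<oplus> w) \<ominus> w = a" "(a \<ominus> w) \<oplus> w = a"
      using w by algebra+
  qed
  have "bij_betw (\<lambda>a. a \<oplus> w) (A \<inter> M) {a \<in> A. a \<ominus> w \<in> M}"
    by (rule bij_betw_byWitness[where f' = "\<lambda>a. a \<ominus> w"]) (use invariant cancel in auto)
  then show ?thesis
    unfolding coset by (simp add: bij_betw_same_card)
qed

lemma card_Int_translation_invariant:
  assumes fin: "finite (carrier R)" and M: "ideal M R" and I: "ideal I R"
    and comaximal: "I <+> M = carrier R"
    and A: "A \<subseteq> carrier R" and invariant: "\<And>a w. a \<in> A \<Longrightarrow> w \<in> I \<Longrightarrow> a \<oplus> w \<in> A"
  shows "card A = card (carrier (R Quot M)) * card (A \<inter> M)"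
proof (rule card_eq_mult_card_fibre)
  interpret I: ideal I R by (rule I)
  interpret M: ideal M R by (rule M)
  interpret h: ring_hom_cring R "R Quot M" "(+>) M" by (rule quotient_hom[OF M])
  show "finite A" "finite (carrier (R Quot M))"
    using A fin finite_subset finite_carrier_quotient by blast+
  show "(+>) M ` A \<subseteq> carrier (R Quot M)"
    using A by (auto simp: carrier_quotient)
  fix C assume C: "C \<in> carrier (R Quot M)"
  then obtain x where x: "x \<in> carrier R" "C = M +> x"
    by (auto simp: carrier_quotient)
  then have "x \<in> I <+> M"
    using comaximal by simp
  then obtain w m where w: "w \<in> I" and m: "m \<in> M" and xwm: "x = w \<oplus> m"
    by (auto simp: set_add_def')
  have "C = M +> w"
    unfolding x(2) xwm using w m rcos_eq_zero_iff[OF M, of m] by simp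
  then show "card {a \<in> A. M +> a = C} = card (A \<inter> M)"
    using card_Int_rcos[OF M A, of w] invariant[of _ w] invariant[of _ "\<ominus> w"] w
    by (simp add: a_minus_def)
qed

end

section \<open>Units and maximal ideals of finite commutative rings\<close>

lemma (in monoid) finite_idempotent_power:
  assumes fin: "finite (carrier G)" and a: "a \<in> carrier G"
  obtains k :: nat where "k > 0" "a [^] k \<otimes> a [^] k = a [^] k"
proof -
  have "\<not> inj (\<lambda>i::nat. a [^] i)"
    using range_inj_infinite[of "\<lambda>i::nat. a [^] i"] a
      finite_subset[OF _ fin, of "range (\<lambda>i::nat. a [^] i)"] by auto
  then obtain i l :: nat where l: "l > 0" and period: "a [^] (i + l) = a [^] i"
    unfolding inj_def by (metis less_imp_add_positive linorder_neqE_nat)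
  have periods: "a [^] (i + c * l) = a [^] i" for c
  proof (induction c)
    case (Suc c)
    have "a [^] (i + Suc c * l) = a [^] (i + c * l) \<otimes> a [^] l"
      using a by (simp add: nat_pow_mult ac_simps)
    then show ?case
      using a period Suc by (simp add: nat_pow_mult)
  qed simp
  define k where "k = Suc i * l"
  have "i \<le> k"
    using l by (cases l) (auto simp: k_def)
  then have "a [^] k \<otimes> a [^] k = a [^] (i + k) \<otimes> a [^] (k - i)"
    using a by (simp add: nat_pow_mult)
  also have "a [^] (i + k) = a [^] i"
    unfolding k_def by (rule periods)
  also have "a [^] i \<otimes> a [^] (k - i) = a [^] k"
    using a \<open>i \<le> k\<close> by (simp add: nat_pow_mult)
  finally show ?thesis
    using that[of k] l by (simp add: k_def)
qed

lemma (in primeideal) I_prime_pow: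
  assumes "x \<in> carrier R" "x [^] (k::nat) \<in> I"
  shows "x \<in> I"
  using assms(2)
proof (induction k)
  case 0
  then show ?case using I_notcarr one_imp_carrier by simp
next
  case (Suc k)
  then show ?case using I_prime[of "x [^] k" x] assms(1) by auto
qed

context cring
begin

lemma ex_maximalideal_containing:
  assumes fin: "finite (carrier R)" and I: "ideal I R" and "\<one> \<notin> I"
  shows "\<exists>M. maximalideal M R \<and> I \<subseteq> M"
proof -
  let ?X = "{J. ideal J R \<and> I \<subseteq> J \<and> \<one> \<notin> J}"
  have "?X \<subseteq> Pow (carrier R)"
    by (auto dest: ideal.Icarr)
  then have "finite ?X"
    using fin by (meson finite_Pow_iff finite_subset)
  moreover have "I \<in> ?X"
    using assms by auto
  ultimately obtain M where M: "M \<in> ?X" and max: "\<forall>J\<in>?X. M \<subseteq> J \<longrightarrow> M = J"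
    by (meson finite_has_maximal2)
  have "maximalideal M R"
  proof (rule maximalidealI)
    show "ideal M R" "carrier R \<noteq> M"
      using M by auto
    show "J = M \<or> J = carrier R" if J: "ideal J R" "M \<subseteq> J" for J
      using ideal.one_imp_carrier[OF J(1)] max J M by blast
  qed
  then show ?thesis
    using M by blast
qed

lemma Units_iff_notin_maximalideal:
  assumes fin: "finite (carrier R)" and a: "a \<in> carrier R"
  shows "a \<in> Units R \<longleftrightarrow> (\<forall>M. maximalideal M R \<longrightarrow> a \<notin> M)"
proof (intro iffI allI impI)
  fix M assume unit: "a \<in> Units R" and M: "maximalideal M R"
  interpret maximalideal M R by (rule M)
  show "a \<notin> M"
    using I_l_closed[of a "inv a"] unit one_notin by auto
next
  assume avoid: "\<forall>M. maximalideal M R \<longrightarrow> a \<notin> M"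
  have "\<one> \<in> PIdl a"
    using ex_maximalideal_containing[OF fin cgenideal_ideal[OF a]] cgenideal_self[OF a] avoid
    by blast
  then obtain b where "b \<in> carrier R" "\<one> = b \<otimes> a"
    by (auto simp: cgenideal_def)
  then show "a \<in> Units R"
    using a m_comm[of a b] by (auto simp: Units_def)
qed

lemma one_minus_idempotent_mem_maximalideal_iff:
  assumes M: "maximalideal M R" and e: "e \<in> carrier R" "e \<otimes> e = e"
  shows "\<one> \<ominus> e \<in> M \<longleftrightarrow> e \<notin> M"
proof
  interpret M: maximalideal M R by (rule M)
  assume "\<one> \<ominus> e \<in> M"
  moreover have "(\<one> \<ominus> e) \<oplus> e = \<one>"
    using e(1) by algebra
  ultimately show "e \<notin> M"
    using M.a_closed M.one_notin by metis
next
  interpret M: maximalideal M R by (rule M)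
  assume "e \<notin> M"
  have "e \<otimes> (\<one> \<ominus> e) = e \<ominus> e \<otimes> e"
    using e(1) by algebra
  then have "e \<otimes> (\<one> \<ominus> e) \<in> M"
    using e by (simp add: a_minus_def r_neg)
  then show "\<one> \<ominus> e \<in> M"
    using primeideal.I_prime[OF maximalideal_prime[OF M]] e(1) \<open>e \<notin> M\<close> by blast
qed

lemma add_one_minus_idempotent_power_Units:
  fixes k :: nat
  assumes fin: "finite (carrier R)" and a: "a \<in> carrier R" and "k > 0"
    and e: "e = a [^] k" "e \<otimes> e = e"
  shows "a \<oplus> (\<one> \<ominus> e) \<in> Units R"
proof -
  have ec: "e \<in> carrier R"
    using a e(1) by simp
  have "a \<oplus> (\<one> \<ominus> e) \<notin> M" if max: "maximalideal M R" for M
  proof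
    assume u: "a \<oplus> (\<one> \<ominus> e) \<in> M"
    interpret M: maximalideal M R by (rule max)
    have "a [^] (k - 1) \<otimes> a = e"
      using \<open>k > 0\<close> by (metis Suc_diff_1 e(1) nat_pow_Suc)
    then have "e \<in> M" if "a \<in> M"
      using M.I_l_closed[OF that, of "a [^] (k - 1)"] a by simp
    then have "a \<in> M \<longleftrightarrow> e \<in> M"
      using primeideal.I_prime_pow[OF maximalideal_prime[OF max] a, of k] e(1) by blast
    moreover have "a \<in> M \<longleftrightarrow> \<one> \<ominus> e \<in> M"
      using u a ec M.add_mem_iff[of a "\<one> \<ominus> e"] M.add_mem_iff[of "\<one> \<ominus> e" a]
      by (auto simp: a_comm)
    ultimately show False
      using one_minus_idempotent_mem_maximalideal_iff[OF max ec e(2)] by blast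
  qed
  then show ?thesis
    using Units_iff_notin_maximalideal[OF fin, of "a \<oplus> (\<one> \<ominus> e)"] a ec by simp
qed

text \<open>If \<open>e\<close> is an idempotent power of \<open>a\<close>, then \<open>1 - e\<close> vanishes in every quotient in which \<open>a\<close> is
  invertible.\<close>

lemma Units_quotient_lift:
  assumes fin: "finite (carrier R)" and I: "ideal I R" and C: "C \<in> Units (R Quot I)"
  shows "\<exists>u\<in>Units R. I +> u = C"
proof -
  interpret h: ring_hom_cring R "R Quot I" "(+>) I" by (rule quotient_hom[OF I])
  obtain a where a: "a \<in> carrier R" and Ca: "C = I +> a"
    using C h.S.Units_closed by (auto simp: carrier_quotient)
  obtain k :: nat where k: "k > 0" and idem: "a [^] k \<otimes> a [^] k = a [^] k"
    using finite_idempotent_power[OF fin a] by auto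
  define e where "e = a [^] k"
  have e: "e \<in> carrier R" "e \<otimes> e = e"
    using a idem by (simp_all add: e_def)
  have "I +> e \<in> Units (R Quot I)"
    using a C h.S.Units_pow_closed[OF C, of k] by (simp add: e_def Ca)
  moreover have "(I +> e) \<otimes>\<^bsub>R Quot I\<^esub> (I +> e) = (I +> e) \<otimes>\<^bsub>R Quot I\<^esub> \<one>\<^bsub>R Quot I\<^esub>"
    using e h.hom_mult[of e e] by simp
  ultimately have "I +> e = \<one>\<^bsub>R Quot I\<^esub>"
    using e h.hom_closed h.S.Units_l_cancel h.S.one_closed by blast
  then have "I +> (a \<oplus> (\<one> \<ominus> e)) = C"
    using a e Ca by (simp add: a_minus_def h.S.r_neg)
  moreover have "a \<oplus> (\<one> \<ominus> e) \<in> Units R"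
    using add_one_minus_idempotent_power_Units[OF fin a k e_def e(2)] .
  ultimately show ?thesis ..
qed

lemma ideal_carrier_Int_Inter:
  assumes "\<And>N. N \<in> F \<Longrightarrow> ideal N R"
  shows "ideal (carrier R \<inter> \<Inter>F) R"
  using i_Intersect[of "insert (carrier R) F"] assms oneideal by auto

end

lemma (in primeideal) subset_of_Inter_subset:
  assumes "finite F" "\<And>N. N \<in> F \<Longrightarrow> ideal N R" "carrier R \<inter> \<Inter>F \<subseteq> I"
  shows "\<exists>N\<in>F. N \<subseteq> I"
  using assms
proof (induction F rule: finite_induct)
  case empty
  then show ?case
    using I_notcarr a_subset by auto
next
  case (insert N F)
  interpret N: ideal N R using insert.prems by simp
  interpret K: ideal "carrier R \<inter> \<Inter>F" R
    using insert.prems by (intro ideal_carrier_Int_Inter) auto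
  show ?case
  proof (cases "N \<subseteq> I")
    case False
    then obtain z where z: "z \<in> N" "z \<notin> I"
      by blast
    have "w \<in> I" if w: "w \<in> carrier R \<inter> \<Inter>F" for w
    proof -
      have "w \<otimes> z \<in> carrier R \<inter> \<Inter>(insert N F)"
        using K.I_r_closed[OF w] N.I_l_closed[OF z(1)] w z N.Icarr by auto
      then show ?thesis
        using I_prime[of w z] insert.prems(2) w z N.Icarr by blast
    qed
    then show ?thesis
      using insert by blast
  qed blast
qed

context cring
begin

lemma maximalideal_add_eq_carrier:
  assumes M: "maximalideal M R" and I: "ideal I R" and "\<not> I \<subseteq> M"
  shows "I <+> M = carrier R"
proof -
  interpret M: maximalideal M R by (rule M)
  interpret I: ideal I R by (rule I)
  have sum: "ideal (I <+> M) R"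
    by (rule add_ideals[OF I M.ideal_axioms])
  have "I \<union> M \<subseteq> I <+> M"
  proof
    fix x assume "x \<in> I \<union> M"
    then have "x \<in> I \<and> x = x \<oplus> \<zero> \<or> x \<in> M \<and> x = \<zero> \<oplus> x"
      using I.Icarr M.Icarr by auto
    then show "x \<in> I <+> M"
      unfolding set_add_def' using I.zero_closed M.zero_closed by blast
  qed
  then show ?thesis
    using M.I_maximal[OF sum] ideal.Icarr[OF sum] \<open>\<not> I \<subseteq> M\<close> by blast
qed

lemma maximalideals_comaximal_Inter:
  assumes "finite F" "\<And>N. N \<in> insert M F \<Longrightarrow> maximalideal N R" "M \<notin> F"
  shows "(carrier R \<inter> \<Inter>F) <+> M = carrier R"
proof (rule maximalideal_add_eq_carrier)
  have ideals: "ideal N R" if "N \<in> F" for N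
    using assms(2) that by (simp add: maximalideal.axioms(1))
  show M: "maximalideal M R"
    using assms(2) by simp
  show "ideal (carrier R \<inter> \<Inter>F) R"
    using ideals by (rule ideal_carrier_Int_Inter)
  show "\<not> carrier R \<inter> \<Inter>F \<subseteq> M"
  proof
    assume "carrier R \<inter> \<Inter>F \<subseteq> M"
    then obtain N where "N \<in> F" "N \<subseteq> M"
      using primeideal.subset_of_Inter_subset[OF maximalideal_prime[OF M] assms(1) ideals] by blast
    moreover have "carrier R \<noteq> M" "M \<subseteq> carrier R"
      using maximalideal.I_notcarr[OF M] ideal.Icarr[OF maximalideal.axioms(1)[OF M]] by auto
    ultimately show False
      using maximalideal.I_maximal[of N R M] maximalideal.axioms(1)[OF M] assms(2,3) by auto
  qed
qed

lemma card_Inter_maximalideals: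
  assumes fin: "finite (carrier R)" and "finite F" "\<And>N. N \<in> F \<Longrightarrow> maximalideal N R"
  shows "card (carrier R) = card (carrier R \<inter> \<Inter>F) * (\<Prod>N\<in>F. card (carrier (R Quot N)))"
  using assms(2,3)
proof (induction F rule: finite_induct)
  case (insert M F)
  let ?I = "carrier R \<inter> \<Inter>F"
  have ideals: "ideal N R" if "N \<in> insert M F" for N
    using insert.prems that by (simp add: maximalideal.axioms(1))
  interpret I: ideal ?I R
    using ideals by (intro ideal_carrier_Int_Inter) simp
  have "card ?I = card (carrier (R Quot M)) * card (?I \<inter> M)"
  proof (rule card_Int_translation_invariant[OF fin _ I.ideal_axioms])
    show "?I <+> M = carrier R"
      using insert by (intro maximalideals_comaximal_Inter)
  qed (use ideals I.a_closed in auto)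
  moreover have "?I \<inter> M = carrier R \<inter> \<Inter>(insert M F)"
    by blast
  ultimately show ?case
    using insert by (simp add: mult_ac)
qed simp

lemma card_notin_maximalideals:
  assumes fin: "finite (carrier R)" and "finite F" "\<And>N. N \<in> F \<Longrightarrow> maximalideal N R"
  shows "real (card {a \<in> carrier R. \<forall>N\<in>F. a \<notin> N})
    = real (card (carrier R)) * (\<Prod>N\<in>F. 1 - 1 / real (card (carrier (R Quot N))))"
  using assms(2,3)
proof (induction F rule: finite_induct)
  case (insert M F)
  define A where "A = {a \<in> carrier R. \<forall>N\<in>F. a \<notin> N}"
  let ?k = "card (carrier (R Quot M))"
  have ideals: "ideal N R" if "N \<in> insert M F" for N
    using insert.prems that by (simp add: maximalideal.axioms(1))
  have "a \<oplus> w \<in> A" if "a \<in> A" "w \<in> carrier R \<inter> \<Inter>F" for a w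
    using that ideals by (auto simp: A_def ideal.add_mem_iff)
  then have card_A: "card A = ?k * card (A \<inter> M)"
    using insert ideals
    by (intro card_Int_translation_invariant[OF fin _ ideal_carrier_Int_Inter]
        maximalideals_comaximal_Inter) (auto simp: A_def)
  have "?k > 0"
    using card_quotient[of M] ideals fin card_gt_0_iff[of "carrier R"] by (intro gr0I) auto
  have "finite A"
    using fin by (simp add: A_def)
  then have "card (A - M) + card (A \<inter> M) = card A"
    by (simp add: card_Diff_subset_Int card_mono)
  then have "real (card (A - M)) = real (card A) - real (card (A \<inter> M))"
    by linarith
  also have "\<dots> = real (card A) * (1 - 1 / real ?k)"
    using \<open>?k > 0\<close> by (simp add: card_A field_simps)
  also have "\<dots> = real (card (carrier R))
      * (\<Prod>N\<in>insert M F. 1 - 1 / real (card (carrier (R Quot N))))"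
    using insert by (simp add: A_def)
  also have "A - M = {a \<in> carrier R. \<forall>N\<in>insert M F. a \<notin> N}"
    by (auto simp: A_def)
  finally show ?case .
qed simp

lemma finite_maximalideals:
  assumes "finite (carrier R)"
  shows "finite {M. maximalideal M R}"
proof (rule finite_subset)
  show "{M. maximalideal M R} \<subseteq> Pow (carrier R)"
    by (auto dest: maximalideal.axioms(1) ideal.Icarr)
qed (use assms in simp)

lemma card_Units:
  assumes "finite (carrier R)"
  shows "real (card (Units R))
    = real (card (carrier R)) * (\<Prod>M | maximalideal M R. 1 - 1 / real (card (carrier (R Quot M))))"
proof -
  have "Units R = {a \<in> carrier R. \<forall>M\<in>{M. maximalideal M R}. a \<notin> M}"
    using Units_iff_notin_maximalideal[OF assms] by auto
  then show ?thesis
    using card_notin_maximalideals[OF assms finite_maximalideals[OF assms]] by simp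
qed

end

definition jacobson_radical :: "('a, 'm) ring_scheme \<Rightarrow> 'a set" where
  "jacobson_radical R = carrier R \<inter> \<Inter>{M. maximalideal M R}"

context cring
begin

lemma ideal_jacobson_radical: "ideal (jacobson_radical R) R"
  unfolding jacobson_radical_def
  by (rule ideal_carrier_Int_Inter) (simp add: maximalideal.axioms(1))

lemma card_quotient_jacobson_radical:
  assumes fin: "finite (carrier R)"
  shows "card (carrier (R Quot jacobson_radical R))
    = (\<Prod>M | maximalideal M R. card (carrier (R Quot M)))"
proof -
  have "card (jacobson_radical R) * card (carrier (R Quot jacobson_radical R))
      = card (jacobson_radical R) * (\<Prod>M | maximalideal M R. card (carrier (R Quot M)))"
    using card_quotient[OF ideal_jacobson_radical]
      card_Inter_maximalideals[OF fin finite_maximalideals[OF fin]]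
    by (simp add: jacobson_radical_def mult.commute)
  then show ?thesis
    using card_ideal_pos[OF fin ideal_jacobson_radical] by simp
qed

lemma one_minus_jacobson_radical_Units:
  assumes fin: "finite (carrier R)" and s: "s \<in> jacobson_radical R"
  shows "\<one> \<ominus> s \<in> Units R"
proof -
  have sc: "s \<in> carrier R"
    using s by (simp add: jacobson_radical_def)
  have "\<one> \<ominus> s \<notin> M" if M: "maximalideal M R" for M
  proof
    assume "\<one> \<ominus> s \<in> M"
    interpret M: maximalideal M R by (rule M)
    have "s \<in> M"
      using s M by (simp add: jacobson_radical_def)
    have "(\<one> \<ominus> s) \<oplus> s = \<one>"
      using sc by algebra
    then show False
      using M.a_closed[OF \<open>\<one> \<ominus> s \<in> M\<close> \<open>s \<in> M\<close>] M.one_notin by simp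
  qed
  then show ?thesis
    using Units_iff_notin_maximalideal[OF fin, of "\<one> \<ominus> s"] sc by simp
qed

lemma finprod_mem_ideal:
  assumes "ideal I R" "finite E" "E \<subseteq> carrier R" "x \<in> E" "x \<in> I"
  shows "(\<Otimes>x\<in>E. x) \<in> I"
proof -
  have "(\<Otimes>x\<in>E. x) = (\<Otimes>x\<in>insert x (E - {x}). x)"
    using assms(4) by (simp add: insert_absorb)
  also have "\<dots> = x \<otimes> (\<Otimes>x\<in>E - {x}. x)"
    using assms(2-4) by (intro finprod_insert) auto
  also have "\<dots> \<in> I"
    using assms(3) by (intro ideal.I_r_closed[OF assms(1)] assms(5) finprod_closed) auto
  finally show ?thesis .
qed

lemma finprod_rcos_one:
  assumes I: "ideal I R"
  shows "(\<Otimes>x\<in>I +> \<one>. x) \<ominus> \<one> \<in> I"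
proof -
  interpret I: ideal I R by (rule I)
  have sub: "I +> \<one> \<subseteq> carrier R"
    by (simp add: a_r_coset_subset_G I.a_subset)
  interpret h: ring_hom_cring R "R Quot I" "(+>) I" by (rule quotient_hom[OF I])
  have rcos: "I +> x = \<one>\<^bsub>R Quot I\<^esub>" if "x \<in> I +> \<one>" for x
  proof -
    obtain i where i: "i \<in> I" "x = i \<oplus> \<one>"
      using \<open>x \<in> I +> \<one>\<close> by (auto simp: a_r_coset_def')
    then have "I +> i = \<zero>\<^bsub>R Quot I\<^esub>"
      by (simp add: rcos_eq_zero_iff[OF I])
    then show ?thesis
      using i by simp
  qed
  have "I +> (\<Otimes>x\<in>I +> \<one>. x) = (\<Otimes>\<^bsub>R Quot I\<^esub>x\<in>I +> \<one>. I +> x)"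
    using sub by (subst h.hom_finprod) (auto simp: o_def)
  also have "\<dots> = \<one>\<^bsub>R Quot I\<^esub>"
    using rcos by (rule h.S.finprod_one_eqI)
  also have "\<dots> = I +> \<one>"
    by simp
  finally show ?thesis
    using sub by (intro rcos_eq_iff[OF I, THEN iffD1] finprod_closed) auto
qed

lemma add_eq_carrier_imp_rcos_one_meets:
  assumes I: "ideal I R" and J: "ideal J R" and "I <+> J = carrier R"
  shows "\<exists>m\<in>I +> \<one>. m \<in> J"
proof -
  interpret I: ideal I R by (rule I)
  interpret J: ideal J R by (rule J)
  have "\<one> \<in> I <+> J"
    using assms(3) by simp
  then obtain i j where i: "i \<in> I" and j: "j \<in> J" and ij: "i \<oplus> j = \<one>"
    unfolding set_add_def' by (clarsimp simp: eq_commute[of \<one>])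
  have "j = \<ominus> i \<oplus> \<one>"
    using i j by (simp add: r_neg1 flip: ij)
  then show ?thesis
    using i j I.a_inv_closed[OF i] unfolding a_r_coset_def' by blast
qed

end

section \<open>Multiples of one and additive generators\<close>

lemma (in ring_hom_cring) hom_add_pow [simp]:
  "x \<in> carrier R \<Longrightarrow> h ([(k::nat)] \<cdot> x) = [k] \<cdot>\<^bsub>S\<^esub> h x"
  by (induction k) auto

definition additively_generated :: "('a, 'm) ring_scheme \<Rightarrow> nat \<Rightarrow> bool" where
  "additively_generated R d \<longleftrightarrow>
     (\<exists>b \<in> {..<d} \<rightarrow> carrier R. \<forall>x\<in>carrier R. \<exists>a::nat \<Rightarrow> nat.
        x = (\<Oplus>\<^bsub>R\<^esub>i\<in>{..<d}. [a i] \<cdot>\<^bsub>R\<^esub> b i))"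

lemma (in ring_hom_cring) additively_generated_image:
  assumes "additively_generated R d" and surj: "h ` carrier R = carrier S"
  shows "additively_generated S d"
proof -
  obtain b where b: "b \<in> {..<d} \<rightarrow> carrier R"
    and gen: "\<And>x. x \<in> carrier R \<Longrightarrow> \<exists>a::nat \<Rightarrow> nat. x = (\<Oplus>i\<in>{..<d}. [a i] \<cdot> b i)"
    using assms(1) unfolding additively_generated_def by blast
  show ?thesis
    unfolding additively_generated_def
  proof (intro bexI ballI)
    show "h \<circ> b \<in> {..<d} \<rightarrow> carrier S"
      using b by (auto simp: Pi_iff)
    fix y assume "y \<in> carrier S"
    then obtain x where x: "x \<in> carrier R" "y = h x"
      using surj by blast
    then obtain a :: "nat \<Rightarrow> nat" where a: "x = (\<Oplus>i\<in>{..<d}. [a i] \<cdot> b i)"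
      using gen by blast
    have "y = (\<Oplus>\<^bsub>S\<^esub>i\<in>{..<d}. h ([a i] \<cdot> b i))"
      using b unfolding x(2) a by (subst hom_finsum) (auto simp: o_def)
    also have "\<dots> = (\<Oplus>\<^bsub>S\<^esub>i\<in>{..<d}. [a i] \<cdot>\<^bsub>S\<^esub> (h \<circ> b) i)"
      using b by (intro S.finsum_cong') (auto simp: Pi_iff)
    finally show "\<exists>a::nat \<Rightarrow> nat. y = (\<Oplus>\<^bsub>S\<^esub>i\<in>{..<d}. [a i] \<cdot>\<^bsub>S\<^esub> (h \<circ> b) i)"
      by blast
  qed
qed

context cring
begin

lemma add_pow_mult_one: "[(i * j :: nat)] \<cdot> \<one> = ([i] \<cdot> \<one>) \<otimes> ([j] \<cdot> \<one>)"
  by (simp add: add_pow_ldistr add.nat_pow_pow mult.commute)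

lemma add_pow_power_one: "[(i ^ k :: nat)] \<cdot> \<one> = ([i] \<cdot> \<one>) [^] k"
  by (induction k) (simp_all only: power_0 nat_pow_0 add.nat_pow_eone one_closed power_Suc2
      add_pow_mult_one nat_pow_Suc)

lemma add_pow_order_eq_zero: "x \<in> carrier R \<Longrightarrow> [card (carrier R)] \<cdot> x = \<zero>"
  using add.pow_order_eq_1[of x] by (simp add: order_def)

abbreviation multiples :: "nat \<Rightarrow> 'a set" where
  "multiples m \<equiv> PIdl ([m] \<cdot> \<one>)"

lemma ideal_multiples: "ideal (multiples m) R"
  by (simp add: cgenideal_ideal)

lemma mem_multiples_iff: "x \<in> multiples m \<longleftrightarrow> (\<exists>y\<in>carrier R. x = [m] \<cdot> y)"
proof -
  have "y \<otimes> [m] \<cdot> \<one> = [m] \<cdot> y" if "y \<in> carrier R" for y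
    using that by (simp add: add_pow_rdistr)
  then show ?thesis
    unfolding cgenideal_def by (simp, metis)
qed

lemma add_pow_mem_multiples: "y \<in> carrier R \<Longrightarrow> [m] \<cdot> y \<in> multiples m"
  by (auto simp: mem_multiples_iff)

lemma multiples_subset: "ideal I R \<Longrightarrow> [m] \<cdot> \<one> \<in> I \<Longrightarrow> multiples m \<subseteq> I"
  by (rule cgenideal_minimal)

lemma add_pow_one_mem_of_dvd:
  fixes m k :: nat
  assumes "ideal I R" "[m] \<cdot> \<one> \<in> I" "m dvd k"
  shows "[k] \<cdot> \<one> \<in> I"
proof -
  obtain c where "k = m * c"
    using \<open>m dvd k\<close> by blast
  then show ?thesis
    using ideal.I_r_closed[OF assms(1,2)] by (simp add: add_pow_mult_one)
qed

lemma one_mem_of_coprime: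
  fixes i j :: nat
  assumes I: "ideal I R" and i: "[i] \<cdot> \<one> \<in> I" and j: "[j] \<cdot> \<one> \<in> I" and "coprime i j"
  shows "\<one> \<in> I"
proof (cases "i = 0")
  case True
  then show ?thesis using assms by auto
next
  case False
  interpret I: ideal I R by (rule I)
  obtain x y where xy: "i * x = j * y + 1"
    using bezout_nat[OF False, of j] \<open>coprime i j\<close> by auto
  have "[(i * x)] \<cdot> \<one> \<in> I" "[(j * y)] \<cdot> \<one> \<in> I"
    using add_pow_one_mem_of_dvd[OF I] i j by simp_all
  moreover have "[(i * x)] \<cdot> \<one> = [(j * y)] \<cdot> \<one> \<oplus> \<one>"
    unfolding xy by simp
  moreover have "\<one> = ([(j * y)] \<cdot> \<one> \<oplus> \<one>) \<ominus> [(j * y)] \<cdot> \<one>"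
    using add.nat_pow_closed[OF one_closed, of "j * y"] by algebra
  ultimately show ?thesis
    using I.minus_closed by metis
qed

lemma add_pow_mod:
  fixes k m :: nat
  assumes x: "x \<in> carrier R" and "[m] \<cdot> x = \<zero>"
  shows "[(k mod m)] \<cdot> x = [k] \<cdot> x"
proof -
  have "[k] \<cdot> x = [(m * (k div m))] \<cdot> x \<oplus> [(k mod m)] \<cdot> x"
    using x by (simp add: add.nat_pow_mult)
  also have "[(m * (k div m))] \<cdot> x = \<zero>"
    using assms by (simp flip: add.nat_pow_pow)
  finally show ?thesis
    using x by simp
qed

lemma card_le_power_if_generated:
  assumes "additively_generated R d" and m: "m > 0"
    and annihilated: "\<And>x. x \<in> carrier R \<Longrightarrow> [m] \<cdot> x = \<zero>"
  shows "card (carrier R) \<le> m ^ d"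
proof -
  obtain b where b: "b \<in> {..<d} \<rightarrow> carrier R"
    and generate: "\<And>x. x \<in> carrier R \<Longrightarrow> \<exists>a::nat \<Rightarrow> nat. x = (\<Oplus>i\<in>{..<d}. [a i] \<cdot> b i)"
    using assms(1) unfolding additively_generated_def by blast
  define lc where "lc a = (\<Oplus>i\<in>{..<d}. [(a i)] \<cdot> b i)" for a :: "nat \<Rightarrow> nat"
  have "carrier R \<subseteq> lc ` ({..<d} \<rightarrow>\<^sub>E {..<m})"
  proof
    fix x assume "x \<in> carrier R"
    then obtain a :: "nat \<Rightarrow> nat" where "x = lc a"
      using generate unfolding lc_def by blast
    also have "\<dots> = lc (\<lambda>i\<in>{..<d}. a i mod m)"
      unfolding lc_def using b add_pow_mod annihilated
      by (intro finsum_cong') (auto simp: Pi_iff)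
    finally show "x \<in> lc ` ({..<d} \<rightarrow>\<^sub>E {..<m})"
      using m by auto
  qed
  then have "card (carrier R) \<le> card ({..<d} \<rightarrow>\<^sub>E {..<m})"
    by (meson card_image_le card_mono finite_PiE finite_imageI finite_lessThan order_trans)
  then show ?thesis
    by (simp add: card_PiE)
qed

lemma card_quotient_multiples_le:
  assumes "additively_generated R d" and m: "m > 0"
  shows "card (carrier (R Quot multiples m)) \<le> m ^ d"
proof -
  let ?Q = "multiples m"
  interpret h: ring_hom_cring R "R Quot ?Q" "(+>) ?Q"
    by (rule quotient_hom[OF ideal_multiples])
  show ?thesis
  proof (rule h.S.card_le_power_if_generated[OF _ m])
    show "additively_generated (R Quot ?Q) d"
      using assms(1) by (rule h.additively_generated_image) (simp add: carrier_quotient)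
    fix C assume "C \<in> carrier (R Quot ?Q)"
    then obtain x where x: "x \<in> carrier R" "C = ?Q +> x"
      by (auto simp: carrier_quotient)
    then have "?Q +> [m] \<cdot> x = \<zero>\<^bsub>R Quot ?Q\<^esub>"
      by (simp add: add_pow_mem_multiples rcos_eq_zero_iff[OF ideal_multiples] del: h.hom_add_pow)
    then show "[m] \<cdot>\<^bsub>R Quot ?Q\<^esub> C = \<zero>\<^bsub>R Quot ?Q\<^esub>"
      using x by simp
  qed
qed

end

lemma (in cring) one_plus_pow_expansion:
  assumes y: "y \<in> carrier R"
  shows "\<exists>t\<in>carrier R. (\<one> \<oplus> y) [^] (k::nat) = \<one> \<oplus> y \<otimes> ([k] \<cdot> \<one> \<oplus> y \<otimes> t)"
proof (induction k)
  case 0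
  show ?case
    using y by (intro bexI[of _ \<zero>]) simp_all
next
  case (Suc k)
  then obtain t where t: "t \<in> carrier R" "(\<one> \<oplus> y) [^] k = \<one> \<oplus> y \<otimes> ([k] \<cdot> \<one> \<oplus> y \<otimes> t)"
    by blast
  define c where "c = [k] \<cdot> \<one>"
  have c: "c \<in> carrier R"
    by (simp add: c_def)
  have "(\<one> \<oplus> y) [^] Suc k = (\<one> \<oplus> y \<otimes> (c \<oplus> y \<otimes> t)) \<otimes> (\<one> \<oplus> y)"
    by (simp add: t(2) c_def)
  also have "\<dots> = \<one> \<oplus> y \<otimes> ((c \<oplus> \<one>) \<oplus> y \<otimes> (t \<oplus> c \<oplus> y \<otimes> t))"
    using y t(1) c by algebra
  also have "c \<oplus> \<one> = [Suc k] \<cdot> \<one>"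
    by (simp add: c_def)
  finally show ?case
    using y t(1) c by blast
qed

section \<open>Homomorphisms of finite fields\<close>

lemma prime_power_if_prime_dvd_binomials:
  fixes p s :: nat
  assumes p: "prime p" and "s > 0" and dvd: "\<And>i. 0 < i \<Longrightarrow> i < s \<Longrightarrow> p dvd (s choose i)"
  shows "\<exists>a. s = p ^ a"
proof -
  define a where "a = multiplicity p s"
  obtain m where m: "s = p ^ a * m" "\<not> p dvd m"
    using \<open>s > 0\<close> p unfolding a_def by (metis multiplicity_decompose' not_prime_unit not_gr_zero)
  then have m_pos: "m > 0"
    using \<open>s > 0\<close> by simp
  have "multiplicity p (s choose p ^ a) = 0"
    using const_p_fac[OF m_pos p, of a] m by (simp add: not_dvd_imp_multiplicity_0)
  moreover have "s choose p ^ a \<noteq> 0"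
    using m m_pos by simp
  ultimately have "\<not> p dvd (s choose p ^ a)"
    using p by (simp add: multiplicity_eq_zero_iff prime_nat_iff)
  then have "s \<le> p ^ a"
    using dvd[of "p ^ a"] p by (force simp: prime_gt_0_nat)
  then show ?thesis
    using m m_pos by (intro exI[of _ a]) (metis le_antisym dvd_imp_le dvd_triv_left \<open>s > 0\<close>)
qed

context UP_cring
begin

lemma coeff_mult_X:
  assumes f: "f \<in> carrier P"
  shows "up_ring.coeff P (f \<otimes>\<^bsub>P\<^esub> up_ring.monom P \<one> 1) n
    = (if n = 0 then \<zero> else up_ring.coeff P f (n - 1))"
proof (cases n)
  case 0
  then show ?thesis using f by (simp add: coeff_mult)
next
  case (Suc m)
  have "up_ring.coeff P (f \<otimes>\<^bsub>P\<^esub> up_ring.monom P \<one> 1) n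
      = (\<Oplus>i\<in>{..n}. up_ring.coeff P f i \<otimes> (if 1 = n - i then \<one> else \<zero>))"
    using f by (simp add: coeff_mult)
  also have "\<dots> = (\<Oplus>i\<in>{..n}. if m = i then up_ring.coeff P f i else \<zero>)"
    using f Suc by (intro R.finsum_cong') (auto simp: Pi_def)
  also have "\<dots> = up_ring.coeff P f m"
    using f Suc by (subst R.finsum_singleton[of m "{..n}"]) auto
  finally show ?thesis using Suc by simp
qed

lemma coeff_binomial_power:
  "up_ring.coeff P ((up_ring.monom P \<one> 1 \<oplus>\<^bsub>P\<^esub> \<one>\<^bsub>P\<^esub>) [^]\<^bsub>P\<^esub> s) i = [(s choose i)] \<cdot> \<one>"
proof (induction s arbitrary: i)
  case 0
  then show ?case by (cases i) auto
next
  case (Suc s)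
  define f where "f = (up_ring.monom P \<one> 1 \<oplus>\<^bsub>P\<^esub> \<one>\<^bsub>P\<^esub>) [^]\<^bsub>P\<^esub> s"
  have f: "f \<in> carrier P"
    by (simp add: f_def)
  have "(up_ring.monom P \<one> 1 \<oplus>\<^bsub>P\<^esub> \<one>\<^bsub>P\<^esub>) [^]\<^bsub>P\<^esub> Suc s = f \<otimes>\<^bsub>P\<^esub> up_ring.monom P \<one> 1 \<oplus>\<^bsub>P\<^esub> f"
    using f by (simp add: f_def P.r_distr)
  then have "up_ring.coeff P ((up_ring.monom P \<one> 1 \<oplus>\<^bsub>P\<^esub> \<one>\<^bsub>P\<^esub>) [^]\<^bsub>P\<^esub> Suc s) i
      = up_ring.coeff P (f \<otimes>\<^bsub>P\<^esub> up_ring.monom P \<one> 1) i \<oplus> up_ring.coeff P f i"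
    using f by (simp del: P.nat_pow_Suc)
  also have "\<dots> = [(Suc s choose i)] \<cdot> \<one>"
    unfolding coeff_mult_X[OF f] unfolding f_def Suc
    by (cases i) (simp_all add: R.add.nat_pow_mult)
  finally show ?case .
qed

end

lemma (in UP_domain) eq_zero_if_eval_eq_zero:
  assumes fin: "finite (carrier R)" and f: "f \<in> carrier P" and "deg R f < card (carrier R)"
    and root: "\<And>t. t \<in> carrier R \<Longrightarrow> UnivPoly.eval R R id t f = \<zero>"
  shows "f = \<zero>\<^bsub>P\<^esub>"
proof (rule ccontr)
  assume "f \<noteq> \<zero>\<^bsub>P\<^esub>"
  then have "card {t \<in> carrier R. UnivPoly.eval R R id t f = \<zero>} \<le> deg R f"
    using roots_bound[OF f _ fin] by blast
  moreover have "{t \<in> carrier R. UnivPoly.eval R R id t f = \<zero>} = carrier R"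
    using root by blast
  ultimately show False
    using assms(3) by simp
qed

text \<open>The polynomial \<open>(X + 1) ^ s - X ^ s - 1\<close> has more roots than its degree allows.\<close>

lemma (in domain) additive_power_map_binomials:
  fixes s :: nat
  assumes fin: "finite (carrier R)" and s: "s < card (carrier R)"
    and additive: "\<And>t. t \<in> carrier R \<Longrightarrow> (t \<oplus> \<one>) [^] s = t [^] s \<oplus> \<one>"
    and i: "0 < i" "i < s"
  shows "[(s choose i)] \<cdot> \<one> = \<zero>"
proof -
  interpret U: UP_domain R "UP R" by unfold_locales
  let ?P = "UP R"
  define E where "E = UnivPoly.eval R R id"
  note eval = U.evalRR_simps[folded E_def]
  define b where "b = up_ring.monom ?P \<one> 1 \<oplus>\<^bsub>?P\<^esub> \<one>\<^bsub>?P\<^esub>"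
  define g where "g = up_ring.monom ?P \<one> s \<oplus>\<^bsub>?P\<^esub> \<one>\<^bsub>?P\<^esub>"
  define f where "f = b [^]\<^bsub>?P\<^esub> s \<ominus>\<^bsub>?P\<^esub> g"
  have closed: "b \<in> carrier ?P" "b [^]\<^bsub>?P\<^esub> k \<in> carrier ?P" "g \<in> carrier ?P" "f \<in> carrier ?P"
    for k :: nat
    by (auto simp: b_def g_def f_def)
  have coeff_f: "up_ring.coeff ?P f j = [(s choose j)] \<cdot> \<one> \<ominus> up_ring.coeff ?P g j" for j
    using closed by (simp add: f_def a_minus_def U.coeff_binomial_power[folded b_def])
  have root: "E t f = \<zero>" if t: "t \<in> carrier R" for t
  proof -
    have "E t (b [^]\<^bsub>?P\<^esub> k) = (t \<oplus> \<one>) [^] k" for k :: nat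
      by (induction k) (use t closed in \<open>simp_all add: b_def eval\<close>)
    moreover have "E t g = t [^] s \<oplus> \<one>"
      using t by (simp add: g_def eval)
    ultimately show ?thesis
      using t closed additive[OF t] by (simp add: f_def eval(2))
  qed
  have "deg R f \<le> s"
    using closed by (intro U.deg_aboveI) (auto simp: coeff_f g_def a_minus_def binomial_eq_0)
  then have "f = \<zero>\<^bsub>?P\<^esub>"
    using U.eq_zero_if_eval_eq_zero[OF fin closed(4), folded E_def] root s by simp
  then show ?thesis
    using coeff_f[of i] i by (simp add: g_def a_minus_def)
qed

lemma (in domain) add_pow_prime_one_eq_zero:
  fixes p f :: nat
  assumes "prime p" and card: "card (carrier R) = p ^ f"
  shows "[p] \<cdot> \<one> = \<zero>"
proof -
  interpret Z: primeideal "{\<zero>}" R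
    by (rule zeroprimeideal)
  have "([p] \<cdot> \<one>) [^] f \<in> {\<zero>}"
    using add_pow_order_eq_zero[of \<one>] by (simp add: card add_pow_power_one)
  then show ?thesis
    using Z.I_prime_pow[of "[p] \<cdot> \<one>" f] by simp
qed

lemma (in domain) additive_power_map_exponent:
  fixes p f s :: nat
  assumes p: "prime p" and card: "card (carrier R) = p ^ f" and s: "0 < s" "s < card (carrier R)"
    and additive: "\<And>t. t \<in> carrier R \<Longrightarrow> (t \<oplus> \<one>) [^] s = t [^] s \<oplus> \<one>"
  shows "\<exists>a. s = p ^ a"
proof (rule prime_power_if_prime_dvd_binomials[OF p s(1)])
  fix i assume i: "0 < i" "i < s"
  have fin: "finite (carrier R)"
    using s(2) by (intro card_ge_0_finite) simp
  show "p dvd (s choose i)"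
  proof (rule ccontr)
    assume "\<not> p dvd (s choose i)"
    then have "coprime p (s choose i)"
      using p by (simp add: prime_imp_coprime)
    moreover have "[(s choose i)] \<cdot> \<one> = \<zero>"
      by (rule additive_power_map_binomials[OF fin s(2) additive i])
    ultimately have "\<one> \<in> {\<zero>}"
      using one_mem_of_coprime[OF zeroideal, of p "s choose i"] add_pow_prime_one_eq_zero[OF p card]
      by simp
    then show False
      by simp
  qed
qed

context field
begin

lemma pow_card_minus_one:
  assumes "finite (carrier R)" "x \<in> carrier R" "x \<noteq> \<zero>"
  shows "x [^] (card (carrier R) - 1) = \<one>"
proof -
  interpret G: group "Multiplicative_Group.mult_of R"
    by (rule field_mult_group)
  show ?thesis
    using G.pow_order_eq_1[of x] order_mult_of[OF assms(1)] assms
    by (simp add: order_def Multiplicative_Group.nat_pow_mult_of)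
qed

lemma one_less_card:
  assumes "finite (carrier R)"
  shows "1 < card (carrier R)"
  using card_mono[OF assms, of "{\<zero>, \<one>}"] by simp

lemma pow_card:
  assumes "finite (carrier R)" "x \<in> carrier R"
  shows "x [^] card (carrier R) = x"
proof -
  obtain N where N: "card (carrier R) = Suc N"
    using one_less_card[OF assms(1)] by (cases "card (carrier R)") auto
  then have "x [^] card (carrier R) = x [^] N \<otimes> x"
    by simp
  then show ?thesis
    using pow_card_minus_one[OF assms] assms(2) N by (cases "x = \<zero>") simp_all
qed

lemma pow_eq_pow_less_card:
  fixes i :: nat
  assumes fin: "finite (carrier R)" and x: "x \<in> carrier R" "x \<noteq> \<zero>"
  obtains s :: nat where "0 < s" "s < card (carrier R)" "x [^] i = x [^] s"
proof -
  define N where "N = card (carrier R) - 1"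
  have N: "0 < N" "N < card (carrier R)"
    using one_less_card[OF fin] by (simp_all add: N_def)
  define s where "s = (if i mod N = 0 then N else i mod N)"
  have "x [^] i = x [^] (N * (i div N)) \<otimes> x [^] (i mod N)"
    using x by (simp add: nat_pow_mult)
  also have "\<dots> = x [^] s"
    using x pow_card_minus_one[OF fin x] by (auto simp: nat_pow_pow[symmetric] s_def N_def)
  finally have "x [^] i = x [^] s" .
  moreover have "0 < s" "s < card (carrier R)"
    using N less_trans[OF mod_less_divisor[OF N(1)] N(2), of i] by (auto simp: s_def)
  ultimately show ?thesis
    using that by blast
qed

lemma ring_hom_is_power_map:
  assumes fin: "finite (carrier R)" and \<phi>: "\<phi> \<in> ring_hom R R"
  shows "\<exists>s::nat. 0 < s \<and> s < card (carrier R) \<and> (\<forall>x\<in>carrier R. \<phi> x = x [^] s)"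
proof -
  interpret \<phi>: ring_hom_cring R R \<phi>
    by unfold_locales (rule \<phi>)
  obtain \<gamma> where \<gamma>: "\<gamma> \<in> carrier R" "\<gamma> \<noteq> \<zero>"
    and generator: "carrier R - {\<zero>} = {\<gamma> [^] i | i::nat. i \<in> UNIV}"
    using finite_field_mult_group_has_gen[OF fin] by auto
  have "\<phi> \<gamma> \<noteq> \<phi> \<zero>"
    using inj_onD[OF non_trivial_field_hom_is_inj[OF \<phi> field_axioms field_axioms], of \<gamma> \<zero>] \<gamma>
    by blast
  then have "\<phi> \<gamma> \<in> carrier R - {\<zero>}"
    using \<gamma> by simp
  then obtain i :: nat where "\<phi> \<gamma> = \<gamma> [^] i"
    unfolding generator by blast
  then obtain s :: nat where s: "0 < s" "s < card (carrier R)" "\<phi> \<gamma> = \<gamma> [^] s"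
    using pow_eq_pow_less_card[OF fin \<gamma>] by metis
  have "\<phi> x = x [^] s" if x: "x \<in> carrier R" for x
  proof (cases "x = \<zero>")
    case False
    then have "x \<in> {\<gamma> [^] i | i::nat. i \<in> UNIV}"
      using x generator by blast
    then obtain j :: nat where "x = \<gamma> [^] j"
      by blast
    then show ?thesis
      using \<gamma> s(3) by (simp add: nat_pow_pow mult.commute)
  qed (use s(1) in \<open>simp add: nat_pow_zero\<close>)
  then show ?thesis
    using s by blast
qed

lemma ring_hom_is_frobenius_power:
  fixes p f :: nat
  assumes p: "prime p" and card: "card (carrier R) = p ^ f" and \<phi>: "\<phi> \<in> ring_hom R R"
  shows "\<exists>a<f. \<forall>x\<in>carrier R. \<phi> x = x [^] (p ^ a)"
proof -
  have fin: "finite (carrier R)"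
    using card p by (metis card.infinite not_prime_0 power_not_zero)
  interpret \<phi>: ring_hom_cring R R \<phi>
    by unfold_locales (rule \<phi>)
  obtain s :: nat where s: "0 < s" "s < card (carrier R)"
    and power: "\<And>x. x \<in> carrier R \<Longrightarrow> \<phi> x = x [^] s"
    using ring_hom_is_power_map[OF fin \<phi>] by blast
  have "(t \<oplus> \<one>) [^] s = t [^] s \<oplus> \<one>" if "t \<in> carrier R" for t
    using that by (simp flip: power)
  then obtain a where a: "s = p ^ a"
    using additive_power_map_exponent[OF p card s] by blast
  then have "a < f"
    using s(2) prime_gt_1_nat[OF p] by (simp add: card)
  then show ?thesis
    using power a by blast
qed

lemma card_pow_eq_pow_le:
  fixes i j :: nat
  assumes fin: "finite (carrier R)" and "i \<noteq> j"
  shows "card {t \<in> carrier R - {\<zero>}. t [^] i = t [^] j} \<le> max i j"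
  using \<open>i \<noteq> j\<close>
proof (induction i j rule: linorder_wlog)
  case (le i j)
  have "{t \<in> carrier R - {\<zero>}. t [^] i = t [^] j} \<subseteq> {t \<in> carrier R. t [^] (j - i) = \<one>}"
  proof
    fix t assume t: "t \<in> {t \<in> carrier R - {\<zero>}. t [^] i = t [^] j}"
    then have "t \<in> Units R"
      by (simp add: field_Units)
    then have "t [^] i \<in> Units R"
      by (rule Units_pow_closed)
    moreover have "t [^] i \<otimes> t [^] (j - i) = t [^] (i + (j - i))"
      using t by (intro nat_pow_mult) simp
    then have "t [^] i \<otimes> t [^] (j - i) = t [^] i \<otimes> \<one>"
      using t \<open>i \<le> j\<close> by simp
    ultimately have "t [^] (j - i) = \<one>"
      using t Units_l_cancel nat_pow_closed one_closed by blast
    then show "t \<in> {t \<in> carrier R. t [^] (j - i) = \<one>}"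
      using t by simp
  qed
  then have "card {t \<in> carrier R - {\<zero>}. t [^] i = t [^] j}
      \<le> card {t \<in> carrier R. t [^] (j - i) = \<one>}"
    using fin by (intro card_mono) auto
  also have "\<dots> \<le> j - i"
    using num_roots_le_deg[OF fin, of "j - i"] le by simp
  finally show ?case
    by simp
next
  case (sym i j)
  then show ?case
    by (simp add: max.commute eq_commute)
qed

lemma card_frobenius_power_eq_pow_le:
  fixes p a n :: nat
  assumes fin: "finite (carrier R)" and p: "prime p" and n: "n > 1" "\<not> primepow n"
  shows "card {t \<in> carrier R - {\<zero>}. t [^] (p ^ a) = t [^] n} \<le> n * p ^ a"
proof -
  have "n \<noteq> p ^ a"
  proof
    assume n_eq: "n = p ^ a"
    then have "a > 0"
      using n(1) by (cases a) auto
    then show False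
      using n(2) p n_eq unfolding primepow_def by blast
  qed
  then have "card {t \<in> carrier R - {\<zero>}. t [^] (p ^ a) = t [^] n} \<le> max (p ^ a) n"
    by (intro card_pow_eq_pow_le[OF fin]) simp
  also have "\<dots> \<le> n * p ^ a"
    using n prime_gt_0_nat[OF p] by simp
  finally show ?thesis .
qed

text \<open>Raising \<open>t ^ (p ^ a) = t ^ n\<close> to the power \<open>p ^ (f - a)\<close> gives \<open>t = t ^ (n * p ^ (f - a))\<close>.\<close>

lemma card_frobenius_power_eq_pow_le_diff:
  fixes p a f n :: nat
  assumes fin: "finite (carrier R)" and p: "prime p" and card: "card (carrier R) = p ^ f"
    and "a \<le> f" and n: "n > 1"
  shows "card {t \<in> carrier R - {\<zero>}. t [^] (p ^ a) = t [^] n} \<le> n * p ^ (f - a)"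
proof -
  define m where "m = n * p ^ (f - a)"
  have "m > 1"
    using n prime_gt_0_nat[OF p] less_le_trans[of 1 n m] by (simp add: m_def)
  have "t [^] (1::nat) = t [^] m" if "t \<in> carrier R" "t [^] (p ^ a) = t [^] n" for t
  proof -
    have "t [^] (1::nat) = t [^] (p ^ a * p ^ (f - a))"
      using that \<open>a \<le> f\<close> pow_card[OF fin, of t] by (simp add: card power_add[symmetric])
    also have "\<dots> = t [^] m"
      using that by (simp add: m_def nat_pow_pow[symmetric])
    finally show ?thesis .
  qed
  then have "card {t \<in> carrier R - {\<zero>}. t [^] (p ^ a) = t [^] n}
      \<le> card {t \<in> carrier R - {\<zero>}. t [^] (1::nat) = t [^] m}"
    using fin by (intro card_mono) auto
  also have "\<dots> \<le> max 1 m"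
    using \<open>m > 1\<close> by (intro card_pow_eq_pow_le[OF fin]) simp
  finally show ?thesis
    using \<open>m > 1\<close> by (simp add: m_def)
qed

lemma card_ring_hom_eq_pow_le:
  fixes p f n :: nat
  assumes p: "prime p" and card: "card (carrier R) = p ^ f" and \<phi>: "\<phi> \<in> ring_hom R R"
    and n: "n > 1" "\<not> primepow n"
  shows "(card {t \<in> carrier R - {\<zero>}. \<phi> t = t [^] n})\<^sup>2 \<le> n\<^sup>2 * p ^ f"
proof -
  have fin: "finite (carrier R)"
    using card p by (metis card.infinite not_prime_0 power_not_zero)
  obtain a where a: "a < f" and frob: "\<And>t. t \<in> carrier R \<Longrightarrow> \<phi> t = t [^] (p ^ a)"
    using ring_hom_is_frobenius_power[OF p card \<phi>] by blast
  define b where "b = min a (f - a)"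
  have "{t \<in> carrier R - {\<zero>}. \<phi> t = t [^] n} = {t \<in> carrier R - {\<zero>}. t [^] (p ^ a) = t [^] n}"
    using frob by auto
  then have "card {t \<in> carrier R - {\<zero>}. \<phi> t = t [^] n} \<le> n * p ^ b"
    using card_frobenius_power_eq_pow_le[OF fin p n, of a]
      card_frobenius_power_eq_pow_le_diff[OF fin p card less_imp_le[OF a] n(1)]
    by (simp add: b_def min_def)
  then have "(card {t \<in> carrier R - {\<zero>}. \<phi> t = t [^] n})\<^sup>2 \<le> (n * p ^ b)\<^sup>2"
    by (rule power_mono) simp
  also have "\<dots> = n\<^sup>2 * p ^ (2 * b)"
    by (simp add: power_mult_distrib power_mult[symmetric] mult.commute)
  also have "\<dots> \<le> n\<^sup>2 * p ^ f"
    using prime_gt_0_nat[OF p] by (simp add: b_def power_increasing)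
  finally show ?thesis .
qed

end

section \<open>Automorphisms of finite commutative rings\<close>

locale finite_cring_automorphism = cring R for R (structure) +
  fixes \<sigma> :: "'a \<Rightarrow> 'a"
  assumes finite_carrier: "finite (carrier R)"
    and automorphism: "\<sigma> \<in> ring_iso R R"
begin

sublocale \<sigma>: ring_hom_cring R R \<sigma>
  using automorphism by unfold_locales (simp add: ring_iso_def)

lemma \<sigma>_image_carrier: "\<sigma> ` carrier R = carrier R"
  using ring_iso_memE(5)[OF automorphism] by (simp add: bij_betw_def)

lemma \<sigma>_inj: "inj_on \<sigma> (carrier R)"
  using ring_iso_memE(5)[OF automorphism] by (simp add: bij_betw_def)

lemma ideal_image_eq:
  assumes "ideal I R" "\<sigma> ` I \<subseteq> I"
  shows "\<sigma> ` I = I"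
  using assms finite_ideal[OF finite_carrier] \<sigma>_inj
  by (intro endo_inj_surj) (auto intro: inj_on_subset dest: ideal.Icarr)

lemma multiples_image: "\<sigma> ` multiples m = multiples m"
proof (rule ideal_image_eq[OF ideal_multiples])
  show "\<sigma> ` multiples m \<subseteq> multiples m"
  proof clarify
    fix x assume "x \<in> multiples m"
    then obtain y where "y \<in> carrier R" "x = [m] \<cdot> y"
      by (auto simp: mem_multiples_iff)
    then show "\<sigma> x \<in> multiples m"
      by (simp add: add_pow_mem_multiples)
  qed
qed

lemma image_rcos:
  assumes I: "ideal I R" and stable: "\<sigma> ` I = I" and x: "x \<in> carrier R"
  shows "\<sigma> ` (I +> x) = I +> \<sigma> x"
proof -
  have coset: "I +> y = (\<lambda>i. i \<oplus> y) ` I" for y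
    by (auto simp: a_r_coset_def')
  have "\<sigma> ` (I +> x) = (\<lambda>i. \<sigma> i \<oplus> \<sigma> x) ` I"
    unfolding coset image_image using x ideal.Icarr[OF I] by (intro image_cong) auto
  also have "\<dots> = (\<lambda>i. i \<oplus> \<sigma> x) ` \<sigma> ` I"
    by (simp add: image_image)
  finally show ?thesis
    unfolding stable coset .
qed

lemma finite_cring_automorphism_quotient:
  assumes I: "ideal I R" and stable: "\<sigma> ` I = I"
  shows "finite_cring_automorphism (R Quot I) ((`) \<sigma>)"
proof -
  interpret h: ring_hom_cring R "R Quot I" "(+>) I" by (rule quotient_hom[OF I])
  note image_rcos = image_rcos[OF I stable]
  have "(`) \<sigma> \<in> ring_iso (R Quot I) (R Quot I)"
  proof (rule ring_iso_memI)
    show "\<sigma> ` C \<in> carrier (R Quot I)" if "C \<in> carrier (R Quot I)" for C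
      using that by (auto simp: carrier_quotient image_rcos)
    show "\<sigma> ` (C \<otimes>\<^bsub>R Quot I\<^esub> D) = \<sigma> ` C \<otimes>\<^bsub>R Quot I\<^esub> \<sigma> ` D"
      and "\<sigma> ` (C \<oplus>\<^bsub>R Quot I\<^esub> D) = \<sigma> ` C \<oplus>\<^bsub>R Quot I\<^esub> \<sigma> ` D"
      if CD: "C \<in> carrier (R Quot I)" "D \<in> carrier (R Quot I)" for C D
    proof -
      obtain x y where "x \<in> carrier R" "y \<in> carrier R" "C = I +> x" "D = I +> y"
        using CD by (auto simp: carrier_quotient)
      then show "\<sigma> ` (C \<otimes>\<^bsub>R Quot I\<^esub> D) = \<sigma> ` C \<otimes>\<^bsub>R Quot I\<^esub> \<sigma> ` D"
        and "\<sigma> ` (C \<oplus>\<^bsub>R Quot I\<^esub> D) = \<sigma> ` C \<oplus>\<^bsub>R Quot I\<^esub> \<sigma> ` D"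
        by (simp_all add: image_rcos flip: h.hom_mult h.hom_add)
    qed
    show "\<sigma> ` \<one>\<^bsub>R Quot I\<^esub> = \<one>\<^bsub>R Quot I\<^esub>"
      by (simp add: image_rcos flip: h.hom_one)
    have "(`) \<sigma> ` carrier (R Quot I) = (+>) I ` \<sigma> ` carrier R"
      by (auto simp: carrier_quotient image_rcos image_image)
    then have "(`) \<sigma> ` carrier (R Quot I) = carrier (R Quot I)"
      by (simp add: carrier_quotient \<sigma>_image_carrier)
    then show "bij_betw ((`) \<sigma>) (carrier (R Quot I)) (carrier (R Quot I))"
      by (simp add: bij_betw_def eq_card_imp_inj_on finite_carrier_quotient[OF finite_carrier])
  qed
  then show ?thesis
    by (intro finite_cring_automorphism.intro finite_cring_automorphism_axioms.intro
        h.S.is_cring finite_carrier_quotient[OF finite_carrier])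
qed

lemma principal_ideal_stable:
  assumes y: "y \<in> carrier R" and s: "s \<in> carrier R" and \<sigma>y: "\<sigma> y = s \<otimes> y"
  shows "\<sigma> ` (PIdl y) \<subseteq> PIdl y"
proof clarify
  fix z assume "z \<in> PIdl y"
  then obtain c where "c \<in> carrier R" "z = c \<otimes> y"
    unfolding cgenideal_def by blast
  then have "\<sigma> z = (\<sigma> c \<otimes> s) \<otimes> y" "\<sigma> c \<otimes> s \<in> carrier R"
    using y s \<sigma>y by (simp_all add: m_assoc)
  then show "\<sigma> z \<in> PIdl y"
    unfolding cgenideal_def by blast
qed

text \<open>As \<open>\<sigma>\<close> maps the ideal \<open>y R\<close> onto itself, \<open>y = a s y\<close> for some \<open>a\<close>, and \<open>1 - a s\<close> is a unit.\<close>

lemma eigenvector_eq_zero: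
  assumes y: "y \<in> carrier R" and s: "s \<in> jacobson_radical R" and \<sigma>y: "\<sigma> y = s \<otimes> y"
  shows "y = \<zero>"
proof -
  interpret J: ideal "jacobson_radical R" R
    by (rule ideal_jacobson_radical)
  have sc: "s \<in> carrier R"
    using s by (rule J.Icarr)
  have "y \<in> \<sigma> ` (PIdl y)"
    using ideal_image_eq[OF cgenideal_ideal[OF y] principal_ideal_stable[OF y sc \<sigma>y]]
      cgenideal_self[OF y] by simp
  then obtain z where "z \<in> PIdl y" and \<sigma>z: "\<sigma> z = y"
    by (metis imageE)
  then obtain c where c: "c \<in> carrier R" "z = c \<otimes> y"
    unfolding cgenideal_def by blast
  define a where "a = \<sigma> c"
  have a: "a \<in> carrier R" and asy: "a \<otimes> (s \<otimes> y) = y"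
    using c y \<sigma>y \<sigma>z by (simp_all add: a_def)
  have "(\<one> \<ominus> a \<otimes> s) \<otimes> y = y \<ominus> a \<otimes> (s \<otimes> y)"
    using a sc y by algebra
  also have "\<dots> = (\<one> \<ominus> a \<otimes> s) \<otimes> \<zero>"
    using a sc y by (simp add: asy a_minus_def r_neg)
  finally have "(\<one> \<ominus> a \<otimes> s) \<otimes> y = (\<one> \<ominus> a \<otimes> s) \<otimes> \<zero>" .
  moreover have "\<one> \<ominus> a \<otimes> s \<in> Units R"
    by (intro one_minus_jacobson_radical_Units finite_carrier J.I_l_closed s a)
  ultimately show ?thesis
    using y Units_l_cancel by blast
qed

lemma power_eigen_minus_one_eigenvector:
  fixes k :: nat
  assumes x: "x \<in> carrier R" "\<sigma> x = x [^] k"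
  shows "\<exists>t\<in>carrier R. \<sigma> (x \<ominus> \<one>) = ([k] \<cdot> \<one> \<oplus> (x \<ominus> \<one>) \<otimes> t) \<otimes> (x \<ominus> \<one>)"
proof -
  define y where "y = x \<ominus> \<one>"
  have y: "y \<in> carrier R" and xy: "x = \<one> \<oplus> y"
    using x(1) unfolding y_def by simp_all algebra
  obtain t where t: "t \<in> carrier R" "x [^] k = \<one> \<oplus> y \<otimes> ([k] \<cdot> \<one> \<oplus> y \<otimes> t)"
    using one_plus_pow_expansion[OF y, of k] xy by auto
  have "\<sigma> y = \<sigma> x \<ominus> \<one>"
    using x(1) by (simp add: y_def)
  also have "\<dots> = (\<one> \<oplus> y \<otimes> ([k] \<cdot> \<one> \<oplus> y \<otimes> t)) \<ominus> \<one>"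
    by (simp only: x(2) t(2))
  also have "\<dots> = ([k] \<cdot> \<one> \<oplus> y \<otimes> t) \<otimes> y"
    using y t(1) add.nat_pow_closed[OF one_closed, of k] by algebra
  finally show ?thesis
    using t(1) unfolding y_def by blast
qed

end

section \<open>Density of the solutions of a power equation\<close>

definition power_eigenunits :: "('a, 'm) ring_scheme \<Rightarrow> ('a \<Rightarrow> 'a) \<Rightarrow> nat \<Rightarrow> 'a set" where
  "power_eigenunits R \<sigma> n = {x \<in> Units R. \<sigma> x = x [^]\<^bsub>R\<^esub> n}"

lemma power_density_eq_card_ratio:
  "power_density R \<sigma> n = real (card (power_eigenunits R \<sigma> n)) / real (card (Units R))"
  by (simp add: power_density_def power_eigenunits_def)

lemma (in group_hom) card_fibre:
  assumes "y \<in> h ` carrier G"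
  shows "card {x \<in> carrier G. h x = y} = card (kernel G H h)"
proof -
  obtain z where z: "z \<in> carrier G" "y = h z"
    using assms by blast
  have "bij_betw (\<lambda>k. k \<otimes> z) (kernel G H h) {x \<in> carrier G. h x = y}"
    by (rule bij_betw_byWitness[where f' = "\<lambda>x. x \<otimes> inv z"])
      (use z in \<open>auto simp: kernel_def G.m_assoc\<close>)
  then show ?thesis
    by (simp add: bij_betw_same_card)
qed

lemma (in group_hom) card_image_mult_card_kernel:
  assumes "finite (carrier G)"
  shows "card (carrier G) = card (h ` carrier G) * card (kernel G H h)"
  using assms card_fibre by (intro card_eq_mult_card_fibre[of _ _ h]) auto

lemma (in group_hom) card_mult_card_image_le:
  assumes fin: "finite (carrier G)" and surj: "h ` carrier G = carrier H"
    and K: "K \<subseteq> carrier G" and L: "L \<subseteq> carrier H" "h ` K \<subseteq> L"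
  shows "card K * card (carrier H) \<le> card L * card (carrier G)"
proof -
  let ?fibre = "\<lambda>y. {x \<in> carrier G. h x = y}"
  have finH: "finite (carrier H)"
    using fin surj by (metis finite_imageI)
  have "finite L"
    using L(1) finH finite_subset by blast
  have "K \<subseteq> (\<Union>y\<in>L. ?fibre y)"
    using K L by blast
  then have "card K \<le> card (\<Union>y\<in>L. ?fibre y)"
    using fin \<open>finite L\<close> by (intro card_mono) auto
  also have "\<dots> \<le> (\<Sum>y\<in>L. card (?fibre y))"
    by (rule card_UN_le[OF \<open>finite L\<close>])
  also have "\<dots> = card L * card (kernel G H h)"
    using L(1) surj card_fibre by (simp add: subset_eq)
  finally have "card K * card (carrier H) \<le> card L * (card (carrier H) * card (kernel G H h))"
    by (simp add: mult_ac mult_le_mono)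
  also have "card (carrier H) * card (kernel G H h) = card (carrier G)"
    using card_image_mult_card_kernel[OF fin] surj by simp
  finally show ?thesis .
qed

lemma (in ring_hom_cring) Units_image:
  assumes "x \<in> Units R"
  shows "h x \<in> Units S"
proof -
  obtain y where y: "y \<in> carrier R" "y \<otimes> x = \<one>" "x \<otimes> y = \<one>"
    using assms by (auto simp: Units_def)
  then have "h y \<otimes>\<^bsub>S\<^esub> h x = \<one>\<^bsub>S\<^esub>" "h x \<otimes>\<^bsub>S\<^esub> h y = \<one>\<^bsub>S\<^esub>"
    using assms hom_mult[of y x] hom_mult[of x y] by auto
  then show ?thesis
    using assms y(1) unfolding Units_def by blast
qed

lemma (in ring_hom_cring) group_hom_Units: "group_hom (units_of R) (units_of S) h"
  by (intro group_hom.intro group_hom_axioms.intro R.units_group S.units_group homI)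
    (auto simp: units_of_carrier units_of_mult Units_image R.Units_closed)

context finite_cring_automorphism
begin

lemma power_density_le_quotient:
  assumes I: "ideal I R" and stable: "\<sigma> ` I = I"
  shows "power_density R \<sigma> n \<le> power_density (R Quot I) ((`) \<sigma>) n"
proof -
  let ?T = "R Quot I"
  interpret h: ring_hom_cring R ?T "(+>) I" by (rule quotient_hom[OF I])
  interpret u: group_hom "units_of R" "units_of ?T" "(+>) I" by (rule h.group_hom_Units)
  have fin_Units: "finite (Units R)" "finite (Units ?T)"
    using finite_carrier finite_carrier_quotient[OF finite_carrier, of I]
    by (auto intro: rev_finite_subset)
  have "card (power_eigenunits R \<sigma> n) * card (carrier (units_of ?T))
      \<le> card (power_eigenunits ?T ((`) \<sigma>) n) * card (carrier (units_of R))"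
  proof (rule u.card_mult_card_image_le)
    show "(+>) I ` carrier (units_of R) = carrier (units_of ?T)"
      using Units_quotient_lift[OF finite_carrier I] h.Units_image by (auto simp: units_of_carrier)
    show "(+>) I ` power_eigenunits R \<sigma> n \<subseteq> power_eigenunits ?T ((`) \<sigma>) n"
    proof clarify
      fix x assume "x \<in> power_eigenunits R \<sigma> n"
      then have x: "x \<in> Units R" "\<sigma> x = x [^] n"
        by (simp_all add: power_eigenunits_def)
      then have "\<sigma> ` (I +> x) = (I +> x) [^]\<^bsub>?T\<^esub> n"
        using image_rcos[OF I stable, of x] by auto
      then show "I +> x \<in> power_eigenunits ?T ((`) \<sigma>) n"
        using x h.Units_image by (simp add: power_eigenunits_def)
    qed
  qed (use fin_Units in \<open>auto simp: units_of_carrier power_eigenunits_def\<close>)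
  moreover have "card (Units R) > 0" "card (Units ?T) > 0"
    using fin_Units Units_one_closed h.S.Units_one_closed by (auto simp: card_gt_0_iff)
  ultimately show ?thesis
    unfolding power_density_eq_card_ratio
    by (simp add: units_of_carrier divide_simps flip: of_nat_mult)
qed

lemma power_density_le_one: "power_density R \<sigma> k \<le> 1"
proof -
  have "finite (Units R)"
    using finite_carrier by (auto intro: rev_finite_subset)
  then have "card (power_eigenunits R \<sigma> k) \<le> card (Units R)"
    by (intro card_mono) (auto simp: power_eigenunits_def)
  then show ?thesis
    by (auto simp: power_density_eq_card_ratio divide_le_eq_1)
qed

lemma power_eigenunits_divide:
  assumes "a \<in> power_eigenunits R \<sigma> k" "b \<in> power_eigenunits R \<sigma> k"
  shows "a \<otimes> inv b \<in> power_eigenunits R \<sigma> k"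
proof -
  have a: "a \<in> Units R" "a \<in> carrier R" "\<sigma> a = a [^] k"
    and b: "b \<in> Units R" "b \<in> carrier R" "inv b \<in> carrier R" "\<sigma> b = b [^] k"
    using assms by (auto simp: power_eigenunits_def)
  have "b [^] k \<otimes> \<sigma> (inv b) = \<one>"
    using b \<sigma>.hom_mult[of b "inv b"] by simp
  moreover have "b [^] k \<otimes> inv b [^] k = \<one>"
    using b by (simp flip: nat_pow_distrib)
  ultimately have "\<sigma> (inv b) = inv b [^] k"
    using b comm_inv_char[of "b [^] k"] by (metis \<sigma>.hom_closed nat_pow_closed)
  then show ?thesis
    using a b by (simp add: power_eigenunits_def nat_pow_distrib)
qed

end

section \<open>Cyclic algebras over residue rings\<close>

locale cyclic_residue_algebra = finite_cring_automorphism R \<sigma>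
  for R (structure) and \<sigma> :: "'a \<Rightarrow> 'a" +
  fixes n d :: nat
  assumes fixed_imp_multiple_of_one:
      "\<And>x. x \<in> carrier R \<Longrightarrow> \<sigma> x = x \<Longrightarrow> \<exists>r::nat. x = [r] \<cdot> \<one>"
    and add_pow_one_eq_zero_iff: "\<And>r::nat. [r] \<cdot> \<one> = \<zero> \<longleftrightarrow> n dvd r"
    and card_carrier: "card (carrier R) = n ^ d"
    and generated: "additively_generated R d"
    and n_gt_one: "n > 1"
begin

lemma one_neq_zero: "\<one> \<noteq> \<zero>"
  using add_pow_one_eq_zero_iff[of 1] n_gt_one by simp

lemma dim_pos: "d > 0"
proof (rule gr0I)
  assume "d = 0"
  moreover have "card {\<zero>, \<one>} \<le> card (carrier R)"
    using finite_carrier by (intro card_mono) auto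
  ultimately show False
    using one_neq_zero card_carrier by simp
qed

lemma add_pow_n_eq_zero: "x \<in> carrier R \<Longrightarrow> [n] \<cdot> x = \<zero>"
  using add_pow_ldistr[of \<one> x n] add_pow_one_eq_zero_iff[of n] by simp

lemma finprod_stable_set_multiple_of_one:
  assumes E: "E \<subseteq> carrier R" and stable: "\<sigma> ` E = E"
  shows "\<exists>r::nat. (\<Otimes>x\<in>E. x) = [r] \<cdot> \<one>"
proof -
  have "\<sigma> (\<Otimes>x\<in>E. x) = (\<Otimes>x\<in>E. \<sigma> x)"
    using E by (subst \<sigma>.hom_finprod) (auto simp: o_def)
  also have "\<dots> = (\<Otimes>x\<in>\<sigma> ` E. x)"
    using stable E inj_on_subset[OF \<sigma>_inj E] by (intro finprod_reindex[symmetric]) auto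
  also have "\<dots> = (\<Otimes>x\<in>E. x)"
    by (simp add: stable)
  finally show ?thesis
    using E by (intro fixed_imp_multiple_of_one finprod_closed) auto
qed

lemma card_annihilator:
  assumes "m > 0"
  shows "card {x \<in> carrier R. [m] \<cdot> x = \<zero>} = card (carrier (R Quot multiples m))"
proof -
  interpret g: group_hom "add_monoid R" "add_monoid R" "\<lambda>x. [m] \<cdot> x"
    by (intro group_hom.intro group_hom_axioms.intro add.is_group homI)
      (auto simp: add.nat_pow_distrib)
  have "card (carrier R) = card (multiples m) * card {x \<in> carrier R. [m] \<cdot> x = \<zero>}"
    using g.card_image_mult_card_kernel finite_carrier
    by (simp add: kernel_def image_def mem_multiples_iff[symmetric])
  also have "card (carrier R) = card (multiples m) * card (carrier (R Quot multiples m))"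
    using card_quotient[OF ideal_multiples, of m] by (simp add: mult.commute)
  finally show ?thesis
    using card_ideal_pos[OF finite_carrier ideal_multiples, of m] by simp
qed

text \<open>For \<open>n = q m\<close> the rings \<open>R / q R\<close> and \<open>R / m R\<close> are as large as possible because the product
  of their bounds \<open>q ^ d\<close> and \<open>m ^ d\<close> is the cardinality of \<open>R\<close>.\<close>

lemma card_quotient_multiples:
  assumes "q dvd n"
  shows "card (carrier (R Quot multiples q)) = q ^ d"
proof -
  obtain m where n: "n = q * m"
    using assms by blast
  then have pos: "m > 0" "q > 0"
    using n_gt_one by (auto intro!: gr0I)
  let ?kq = "card (carrier (R Quot multiples q))" and ?km = "card (carrier (R Quot multiples m))"
  have "multiples q \<subseteq> {x \<in> carrier R. [m] \<cdot> x = \<zero>}"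
    using add_pow_n_eq_zero by (auto simp: mem_multiples_iff add.nat_pow_pow n)
  then have "card (multiples q) \<le> ?km"
    using finite_carrier card_mono[of "{x \<in> carrier R. [m] \<cdot> x = \<zero>}"] card_annihilator[OF pos(1)]
    by simp
  then have "?kq * card (multiples q) \<le> ?kq * ?km"
    by simp
  then have lower: "q ^ d * m ^ d \<le> ?kq * ?km"
    using card_quotient[OF ideal_multiples, of q] card_carrier by (simp add: n power_mult_distrib)
  have upper: "?kq \<le> q ^ d" "?km \<le> m ^ d"
    using card_quotient_multiples_le[OF generated] pos by blast+
  have "?kq * ?km \<le> ?kq * m ^ d"
    using upper(2) by simp
  then have "q ^ d * m ^ d \<le> ?kq * m ^ d"
    using lower by linarith
  then have "q ^ d \<le> ?kq"
    using pos by simp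
  then show ?thesis
    using upper(1) by simp
qed

lemma mem_multiples_iff_annihilated:
  assumes n: "n = m * q" and x: "x \<in> carrier R"
  shows "x \<in> multiples q \<longleftrightarrow> [m] \<cdot> x = \<zero>"
proof -
  have pos: "m > 0" "q > 0"
    using n n_gt_one by (auto intro!: gr0I)
  have "card (multiples q) * q ^ d = m ^ d * q ^ d"
    using card_quotient[OF ideal_multiples, of q] card_quotient_multiples[of q] card_carrier
    by (simp add: n power_mult_distrib mult.commute)
  then have "card (multiples q) = card {x \<in> carrier R. [m] \<cdot> x = \<zero>}"
    using card_annihilator[OF pos(1)] card_quotient_multiples[of m] pos by (simp add: n)
  moreover have "multiples q \<subseteq> {x \<in> carrier R. [m] \<cdot> x = \<zero>}"
    using add_pow_n_eq_zero by (auto simp: mem_multiples_iff add.nat_pow_pow n mult.commute)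
  ultimately have "multiples q = {x \<in> carrier R. [m] \<cdot> x = \<zero>}"
    using finite_carrier by (intro card_subset_eq) auto
  then show ?thesis
    using x by blast
qed

lemma fixed_mod_imp_multiple_of_one:
  assumes n: "n = m * q" and x: "x \<in> carrier R" and fixed: "\<sigma> x \<ominus> x \<in> multiples q"
  shows "\<exists>r::nat. x \<ominus> [r] \<cdot> \<one> \<in> multiples q"
proof -
  have add_pow_minus: "[m] \<cdot> (y \<ominus> z) = [m] \<cdot> y \<ominus> [m] \<cdot> z" if "y \<in> carrier R" "z \<in> carrier R" for y z
    using that by (simp add: a_minus_def add.nat_pow_distrib add.nat_pow_inv)
  have "\<sigma> ([m] \<cdot> x) \<ominus> [m] \<cdot> x = \<zero>"
    using mem_multiples_iff_annihilated[OF n, of "\<sigma> x \<ominus> x"] fixed x by (simp add: add_pow_minus)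
  then obtain r :: nat where mx: "[m] \<cdot> x = [r] \<cdot> \<one>"
    using fixed_imp_multiple_of_one[of "[m] \<cdot> x"] x by auto
  have "[(r * q)] \<cdot> \<one> = [q] \<cdot> ([m] \<cdot> x)"
    by (simp add: mx add.nat_pow_pow)
  also have "\<dots> = \<zero>"
    using x add_pow_n_eq_zero by (simp add: n add.nat_pow_pow)
  finally have "m * q dvd r * q"
    using add_pow_one_eq_zero_iff n by simp
  then have "m dvd r"
    using n n_gt_one by (cases "q = 0") simp_all
  then obtain k where "r = k * m"
    by (metis dvdE mult.commute)
  then have "[m] \<cdot> (x \<ominus> [k] \<cdot> \<one>) = [m] \<cdot> x \<ominus> [r] \<cdot> \<one>"
    using x by (simp add: add_pow_minus add.nat_pow_pow)
  also have "\<dots> = \<zero>"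
    by (simp add: mx a_minus_def r_neg)
  finally show ?thesis
    using mem_multiples_iff_annihilated[OF n, of "x \<ominus> [k] \<cdot> \<one>"] x by auto
qed

lemma fixed_quotient_imp_multiple_of_one:
  assumes "q dvd n" and C: "C \<in> carrier (R Quot multiples q)" and fixed: "\<sigma> ` C = C"
  shows "\<exists>r::nat. C = [r] \<cdot>\<^bsub>R Quot multiples q\<^esub> \<one>\<^bsub>R Quot multiples q\<^esub>"
proof -
  let ?Q = "multiples q"
  interpret h: ring_hom_cring R "R Quot ?Q" "(+>) ?Q"
    by (rule quotient_hom[OF ideal_multiples])
  obtain m where n: "n = m * q"
    using assms(1) by (metis dvdE mult.commute)
  obtain x where x: "x \<in> carrier R" "C = ?Q +> x"
    using C by (auto simp: carrier_quotient)
  have "?Q +> \<sigma> x = ?Q +> x"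
    using fixed image_rcos[OF ideal_multiples multiples_image x(1)]
    by (simp add: x(2))
  then have "\<sigma> x \<ominus> x \<in> ?Q"
    using rcos_eq_iff[OF ideal_multiples, of "\<sigma> x" x q] x(1) by simp
  then obtain r :: nat where "x \<ominus> [r] \<cdot> \<one> \<in> ?Q"
    using fixed_mod_imp_multiple_of_one[OF n x(1)] by blast
  then have "C = ?Q +> [r] \<cdot> \<one>"
    using x rcos_eq_iff[OF ideal_multiples, of x "[r] \<cdot> \<one>" q] by simp
  then show ?thesis
    by auto
qed

lemma add_pow_one_quotient_eq_zero_iff:
  fixes r :: nat
  assumes "q dvd n"
  shows "[r] \<cdot>\<^bsub>R Quot multiples q\<^esub> \<one>\<^bsub>R Quot multiples q\<^esub> = \<zero>\<^bsub>R Quot multiples q\<^esub> \<longleftrightarrow> q dvd r"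
proof -
  let ?Q = "multiples q"
  interpret h: ring_hom_cring R "R Quot ?Q" "(+>) ?Q"
    by (rule quotient_hom[OF ideal_multiples])
  obtain m where n: "n = m * q"
    using assms by (metis dvdE mult.commute)
  have "[r] \<cdot>\<^bsub>R Quot ?Q\<^esub> \<one>\<^bsub>R Quot ?Q\<^esub> = ?Q +> [r] \<cdot> \<one>"
    by simp
  then have "[r] \<cdot>\<^bsub>R Quot ?Q\<^esub> \<one>\<^bsub>R Quot ?Q\<^esub> = \<zero>\<^bsub>R Quot ?Q\<^esub> \<longleftrightarrow> [m] \<cdot> ([r] \<cdot> \<one>) = \<zero>"
    using rcos_eq_zero_iff[OF ideal_multiples] mem_multiples_iff_annihilated[OF n]
    by (simp only: one_closed add.nat_pow_closed)
  also have "\<dots> \<longleftrightarrow> n dvd m * r"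
    by (simp add: add.nat_pow_pow mult.commute flip: add_pow_one_eq_zero_iff)
  also have "\<dots> \<longleftrightarrow> q dvd r"
    using n n_gt_one by (cases "m = 0") simp_all
  finally show ?thesis .
qed

lemma cyclic_residue_algebra_quotient:
  assumes "q dvd n" "q > 1"
  shows "cyclic_residue_algebra (R Quot multiples q) ((`) \<sigma>) q d"
proof -
  interpret h: ring_hom_cring R "R Quot multiples q" "(+>) (multiples q)"
    by (rule quotient_hom[OF ideal_multiples])
  show ?thesis
  proof (intro cyclic_residue_algebra.intro cyclic_residue_algebra_axioms.intro)
    show "finite_cring_automorphism (R Quot multiples q) ((`) \<sigma>)"
      by (rule finite_cring_automorphism_quotient[OF ideal_multiples multiples_image])
    show "additively_generated (R Quot multiples q) d"
      by (rule h.additively_generated_image[OF generated]) (simp add: carrier_quotient)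
  qed (fact assms(2) card_quotient_multiples[OF assms(1)]
      fixed_quotient_imp_multiple_of_one[OF assms(1)]
      add_pow_one_quotient_eq_zero_iff[OF assms(1)])+
qed

end

section \<open>Reduction modulo a prime power\<close>

locale cyclic_prime_power_algebra = cyclic_residue_algebra R \<sigma> "p ^ v" d
  for R (structure) and \<sigma> and p v d :: nat +
  assumes prime_p: "prime p"
begin

lemma p_mem_primeideal:
  assumes "primeideal M R"
  shows "[p] \<cdot> \<one> \<in> M"
proof -
  interpret M: primeideal M R by (rule assms)
  have "([p] \<cdot> \<one>) [^] v \<in> M"
    using add_pow_n_eq_zero[of \<one>] by (simp flip: add_pow_power_one)
  then show ?thesis
    using M.I_prime_pow[of "[p] \<cdot> \<one>" v] by simp
qed

lemma p_dvd_of_add_pow_one_mem: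
  fixes r :: nat
  assumes M: "maximalideal M R" and r: "[r] \<cdot> \<one> \<in> M"
  shows "p dvd r"
proof (rule ccontr)
  assume "\<not> p dvd r"
  then have "coprime p r"
    using prime_p by (simp add: prime_imp_coprime)
  then show False
    using one_mem_of_coprime[OF maximalideal.axioms(1)[OF M] p_mem_primeideal r]
      maximalideal_prime[OF M] maximalideal.one_notin[OF M] by blast
qed

text \<open>If \<open>N\<close> does not contain \<open>J\<close>, it contains an element of \<open>1 + J\<close>. The product of all elements
  of \<open>1 + J\<close> is fixed by \<open>\<sigma>\<close>, hence an integer multiple of \<open>1\<close>, and it lies in \<open>N\<close> but not in the
  maximal ideals above \<open>J\<close>, although all of these have residue characteristic \<open>p\<close>.\<close>

lemma stable_ideal_subset_maximalideal:
  assumes J: "ideal J R" "\<one> \<notin> J" and stable: "\<sigma> ` J \<subseteq> J" and N: "maximalideal N R"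
  shows "J \<subseteq> N"
proof (rule ccontr)
  assume "\<not> J \<subseteq> N"
  let ?E = "J +> \<one>"
  define w where "w = (\<Otimes>x\<in>?E. x)"
  have E: "?E \<subseteq> carrier R"
    by (simp add: a_r_coset_subset_G additive_subgroup.a_subset ideal.axioms(1)[OF J(1)])
  then have w: "w \<in> carrier R"
    unfolding w_def by (intro finprod_closed) auto
  have "\<sigma> ` ?E = ?E"
    using image_rcos[OF J(1) ideal_image_eq[OF J(1) stable] one_closed]
    by simp
  then obtain r :: nat where r: "w = [r] \<cdot> \<one>"
    using finprod_stable_set_multiple_of_one[OF E] unfolding w_def by blast
  have "J <+> N = carrier R"
    by (rule maximalideal_add_eq_carrier[OF N J(1) \<open>\<not> J \<subseteq> N\<close>])
  then obtain m where "m \<in> ?E" "m \<in> N"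
    using add_eq_carrier_imp_rcos_one_meets[OF J(1)] maximalideal.axioms(1)[OF N] by blast
  then have "w \<in> N"
    unfolding w_def using E finite_subset[OF E finite_carrier] maximalideal.axioms(1)[OF N]
    by (intro finprod_mem_ideal)
  then have "p dvd r"
    using p_dvd_of_add_pow_one_mem[OF N] r by simp
  obtain M where M: "maximalideal M R" "J \<subseteq> M"
    using ex_maximalideal_containing[OF finite_carrier J] by blast
  interpret M: maximalideal M R by (rule M(1))
  have "w \<in> M"
    using add_pow_one_mem_of_dvd[OF M.ideal_axioms p_mem_primeideal \<open>p dvd r\<close>]
      maximalideal_prime[OF M(1)] r by simp
  moreover have "w \<ominus> \<one> \<in> M"
    using finprod_rcos_one[OF J(1)] M(2) unfolding w_def by blast
  ultimately have "w \<ominus> (w \<ominus> \<one>) \<in> M"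
    by (rule M.minus_closed)
  moreover have "w \<ominus> (w \<ominus> \<one>) = \<one>"
    using w by algebra
  ultimately show False
    using M.one_notin by simp
qed

lemma stable_ideal_subset_jacobson_radical:
  assumes "ideal J R" "\<one> \<notin> J" "\<sigma> ` J \<subseteq> J"
  shows "J \<subseteq> jacobson_radical R"
  using stable_ideal_subset_maximalideal[OF assms] ideal.Icarr[OF assms(1)]
  unfolding jacobson_radical_def by blast

lemma multiples_p_subset_jacobson_radical: "multiples p \<subseteq> jacobson_radical R"
  using p_mem_primeideal maximalideal_prime
  by (intro multiples_subset ideal_jacobson_radical) (auto simp: jacobson_radical_def)

text \<open>With \<open>y = x - 1\<close> and \<open>\<sigma> y = s y\<close>, the ideal \<open>y R\<close> is stable and therefore contained in the
  Jacobson radical, which then also contains \<open>s = k + y t\<close>.\<close>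

lemma power_eigen_eq_one:
  assumes M: "maximalideal M R" and x: "x \<in> carrier R" "\<sigma> x = x [^] k" and "p dvd k"
    and xM: "x \<ominus> \<one> \<in> M"
  shows "x = \<one>"
proof -
  interpret M: maximalideal M R by (rule M)
  interpret J: ideal "jacobson_radical R" R
    by (rule ideal_jacobson_radical)
  define y where "y = x \<ominus> \<one>"
  have y: "y \<in> carrier R" "y \<in> M"
    using x(1) xM by (simp_all add: y_def)
  obtain t where t: "t \<in> carrier R" and \<sigma>y: "\<sigma> y = ([k] \<cdot> \<one> \<oplus> y \<otimes> t) \<otimes> y"
    using power_eigen_minus_one_eigenvector[OF x] unfolding y_def by blast
  have s: "[k] \<cdot> \<one> \<oplus> y \<otimes> t \<in> carrier R"
    using y t by simp
  have "PIdl y \<subseteq> M"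
    by (rule cgenideal_minimal[OF M.ideal_axioms y(2)])
  then have "\<one> \<notin> PIdl y"
    using M.one_notin by blast
  then have "PIdl y \<subseteq> jacobson_radical R"
    using stable_ideal_subset_jacobson_radical cgenideal_ideal[OF y(1)]
      principal_ideal_stable[OF y(1) s \<sigma>y] by blast
  then have "y \<in> jacobson_radical R"
    using cgenideal_self[OF y(1)] by blast
  moreover have "[p] \<cdot> \<one> \<in> jacobson_radical R"
    using multiples_p_subset_jacobson_radical add_pow_mem_multiples[OF one_closed] by blast
  then have "[k] \<cdot> \<one> \<in> jacobson_radical R"
    using add_pow_one_mem_of_dvd[OF J.ideal_axioms _ \<open>p dvd k\<close>] by blast
  ultimately have "[k] \<cdot> \<one> \<oplus> y \<otimes> t \<in> jacobson_radical R"
    using t by (intro J.a_closed J.I_r_closed)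
  then have "y = \<zero>"
    by (rule eigenvector_eq_zero[OF y(1) _ \<sigma>y])
  then show ?thesis
    using x(1) by (simp add: y_def)
qed

lemma inj_on_power_eigenunits:
  assumes M: "maximalideal M R" and "p dvd k"
  shows "inj_on ((+>) M) (power_eigenunits R \<sigma> k)"
proof (rule inj_onI)
  fix a b assume ab: "a \<in> power_eigenunits R \<sigma> k" "b \<in> power_eigenunits R \<sigma> k" "M +> a = M +> b"
  interpret M: maximalideal M R by (rule M)
  have quotient: "a \<otimes> inv b \<in> power_eigenunits R \<sigma> k"
    by (rule power_eigenunits_divide[OF ab(1,2)])
  have a: "a \<in> carrier R" and b: "b \<in> Units R" "b \<in> carrier R" "inv b \<in> carrier R"
    using ab by (auto simp: power_eigenunits_def)
  have "a \<otimes> inv b \<ominus> \<one> \<in> M"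
  proof -
    have "a \<ominus> b \<in> M"
      using ab(3) a b rcos_eq_iff[OF M.ideal_axioms] by simp
    moreover have "a \<otimes> inv b \<ominus> b \<otimes> inv b = (a \<ominus> b) \<otimes> inv b"
      using a b(2,3) by algebra
    ultimately show ?thesis
      using b M.I_r_closed by simp
  qed
  then have "a \<otimes> inv b = \<one>"
    using power_eigen_eq_one[OF M _ _ \<open>p dvd k\<close>] quotient by (auto simp: power_eigenunits_def)
  then have "a \<otimes> (inv b \<otimes> b) = b"
    using a b by (simp flip: m_assoc del: Units_l_inv)
  then show "a = b"
    using a b by simp
qed

lemma card_quotient_le_if_multiples_p_subset:
  assumes "ideal I R" "multiples p \<subseteq> I"
  shows "card (carrier (R Quot I)) \<le> p ^ d"
  using card_quotient_antimono[OF finite_carrier ideal_multiples assms]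
    card_quotient_multiples_le[OF generated, of p] prime_gt_0_nat[OF prime_p] by simp

lemma multiples_p_subset_maximalideal: "maximalideal M R \<Longrightarrow> multiples p \<subseteq> M"
  using multiples_p_subset_jacobson_radical by (auto simp: jacobson_radical_def)

lemma card_residue_field:
  assumes M: "maximalideal M R"
  obtains f where "0 < f" "f \<le> d" "card (carrier (R Quot M)) = p ^ f"
proof -
  interpret M: maximalideal M R by (rule M)
  interpret k: field "R Quot M"
    by (rule M.quotient_is_field[OF is_cring])
  have "card (carrier (R Quot M)) dvd p ^ (v * d)"
    using card_quotient[OF M.ideal_axioms] card_carrier by (metis dvd_triv_left power_mult)
  then obtain f where f: "card (carrier (R Quot M)) = p ^ f"
    using prime_p by (metis divides_primepow_nat)
  moreover have "f > 0"
    using k.one_less_card[OF finite_carrier_quotient[OF finite_carrier]] by (cases f) (auto simp: f)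
  moreover have "p ^ f \<le> p ^ d"
    using card_quotient_le_if_multiples_p_subset[OF M.ideal_axioms] f
      multiples_p_subset_maximalideal[OF M] by simp
  then have "f \<le> d"
    using prime_gt_1_nat[OF prime_p] power_le_imp_le_exp by blast
  ultimately show ?thesis
    using that by blast
qed

text \<open>Here \<open>M\<close> and its preimage under \<open>\<sigma>\<close> are comaximal.\<close>

lemma card_residue_field_moved:
  assumes M: "maximalideal M R" and moved: "\<sigma> ` M \<noteq> M"
  shows "(card (carrier (R Quot M)))\<^sup>2 \<le> p ^ d"
proof -
  interpret M: maximalideal M R by (rule M)
  define M' where "M' = {x \<in> carrier R. \<sigma> x \<in> M}"
  have "\<sigma> ` M' = \<sigma> ` carrier R \<inter> M"
    by (auto simp: M'_def)
  then have image: "\<sigma> ` M' = M"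
    using M.a_subset by (simp add: \<sigma>_image_carrier Int_absorb1)
  have "ring_hom_ring R R \<sigma>"
    by (rule ring_hom_ringI2[OF ring_axioms ring_axioms \<sigma>.homh])
  then interpret M': ideal M' R
    unfolding M'_def by (rule ring_hom_ring.ideal_vimage[OF _ M.ideal_axioms])
  have card_M': "card M' = card M"
    using image card_image[OF inj_on_subset[OF \<sigma>_inj M'.a_subset]] by simp
  then have "\<not> M' \<subseteq> M"
    using card_subset_eq[OF finite_ideal[OF finite_carrier M.ideal_axioms], of M'] image moved
    by auto
  then have "card M' = card (carrier (R Quot M)) * card (M' \<inter> M)"
    by (intro card_Int_translation_invariant[OF finite_carrier M.ideal_axioms M'.ideal_axioms]
        maximalideal_add_eq_carrier M M'.ideal_axioms M'.a_subset M'.a_closed)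
  then have "card (carrier R) = (card (carrier (R Quot M)))\<^sup>2 * card (M' \<inter> M)"
    using card_quotient[OF M.ideal_axioms] card_M' by (simp add: power2_eq_square mult.assoc)
  moreover have Int: "ideal (M' \<inter> M) R"
    by (rule i_intersect[OF M'.ideal_axioms M.ideal_axioms])
  ultimately have "(card (carrier (R Quot M)))\<^sup>2 = card (carrier (R Quot (M' \<inter> M)))"
    using card_quotient[OF Int] card_ideal_pos[OF finite_carrier Int] by simp
  also have "multiples p \<subseteq> M' \<inter> M"
    using multiples_p_subset_maximalideal[OF M] multiples_image[of p]
      ideal.Icarr[OF ideal_multiples] unfolding M'_def by blast
  then have "card (carrier (R Quot (M' \<inter> M))) \<le> p ^ d"
    by (rule card_quotient_le_if_multiples_p_subset[OF Int])
  finally show ?thesis .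
qed

lemma image_power_eigenunits_residue_field:
  assumes M: "maximalideal M R" and stable: "\<sigma> ` M = M"
  shows "(+>) M ` power_eigenunits R \<sigma> k
    \<subseteq> {t \<in> carrier (R Quot M) - {\<zero>\<^bsub>R Quot M\<^esub>}. \<sigma> ` t = t [^]\<^bsub>R Quot M\<^esub> k}"
proof clarify
  fix x assume "x \<in> power_eigenunits R \<sigma> k"
  then have x: "x \<in> Units R" "x \<in> carrier R" "\<sigma> x = x [^] k"
    by (auto simp: power_eigenunits_def)
  interpret M: maximalideal M R by (rule M)
  interpret h: ring_hom_cring R "R Quot M" "(+>) M" by (rule quotient_hom[OF M.ideal_axioms])
  have "M +> x \<noteq> \<zero>\<^bsub>R Quot M\<^esub>"
    using Units_iff_notin_maximalideal[OF finite_carrier x(2)] x(1) M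
      rcos_eq_zero_iff[OF M.ideal_axioms x(2)] by blast
  moreover have "\<sigma> ` (M +> x) = (M +> x) [^]\<^bsub>R Quot M\<^esub> k"
    using image_rcos[OF M.ideal_axioms stable x(2)] x by simp
  ultimately show "M +> x \<in> carrier (R Quot M) - {\<zero>\<^bsub>R Quot M\<^esub>}
      \<and> \<sigma> ` (M +> x) = (M +> x) [^]\<^bsub>R Quot M\<^esub> k"
    using x(2) by simp
qed

lemma card_image_power_eigenunits_stable:
  assumes M: "maximalideal M R" and stable: "\<sigma> ` M = M" and k: "k > 1" "\<not> primepow k"
  shows "(card ((+>) M ` power_eigenunits R \<sigma> k))\<^sup>2 \<le> k\<^sup>2 * p ^ d"
proof -
  let ?T = "{t \<in> carrier (R Quot M) - {\<zero>\<^bsub>R Quot M\<^esub>}. \<sigma> ` t = t [^]\<^bsub>R Quot M\<^esub> k}"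
  interpret M: maximalideal M R by (rule M)
  interpret F: field "R Quot M"
    by (rule M.quotient_is_field[OF is_cring])
  obtain f where f: "f \<le> d" "card (carrier (R Quot M)) = p ^ f"
    using card_residue_field[OF M] by blast
  have hom: "(`) \<sigma> \<in> ring_hom (R Quot M) (R Quot M)"
    using finite_cring_automorphism.automorphism[OF finite_cring_automorphism_quotient]
      M.ideal_axioms stable by (simp add: ring_iso_def)
  have "card ((+>) M ` power_eigenunits R \<sigma> k) \<le> card ?T"
    using finite_carrier_quotient[OF finite_carrier]
      image_power_eigenunits_residue_field[OF M stable] by (intro card_mono) auto
  then have "(card ((+>) M ` power_eigenunits R \<sigma> k))\<^sup>2 \<le> (card ?T)\<^sup>2"
    by (simp add: power_mono)
  also have "\<dots> \<le> k\<^sup>2 * p ^ f"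
    by (rule F.card_ring_hom_eq_pow_le[OF prime_p f(2) hom k])
  also have "\<dots> \<le> k\<^sup>2 * p ^ d"
    using f(1) prime_gt_0_nat[OF prime_p] by (simp add: power_increasing)
  finally show ?thesis .
qed

lemma card_image_power_eigenunits_moved:
  assumes M: "maximalideal M R" and moved: "\<sigma> ` M \<noteq> M" and k: "k > 0"
  shows "(card ((+>) M ` power_eigenunits R \<sigma> k))\<^sup>2 \<le> k\<^sup>2 * p ^ d"
proof -
  have "card ((+>) M ` power_eigenunits R \<sigma> k) \<le> card (carrier (R Quot M))"
    using finite_carrier_quotient[OF finite_carrier]
    by (intro card_mono) (auto simp: carrier_quotient power_eigenunits_def)
  then have "(card ((+>) M ` power_eigenunits R \<sigma> k))\<^sup>2 \<le> (card (carrier (R Quot M)))\<^sup>2"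
    by (simp add: power_mono)
  also have "\<dots> \<le> p ^ d"
    by (rule card_residue_field_moved[OF M moved])
  also have "\<dots> \<le> k\<^sup>2 * p ^ d"
    using k by simp
  finally show ?thesis .
qed

lemma card_power_eigenunits_le:
  assumes "p dvd k" and k: "k > 1" "\<not> primepow k"
  shows "(card (power_eigenunits R \<sigma> k))\<^sup>2 \<le> k\<^sup>2 * p ^ d"
proof -
  have "\<exists>M. maximalideal M R"
    using ex_maximalideal_containing[OF finite_carrier zeroideal] one_neq_zero by auto
  then obtain M where M: "maximalideal M R" ..
  then have "card (power_eigenunits R \<sigma> k) = card ((+>) M ` power_eigenunits R \<sigma> k)"
    using card_image[OF inj_on_power_eigenunits[OF _ \<open>p dvd k\<close>]] by simp
  then show ?thesis
    using card_image_power_eigenunits_stable[OF M _ k] card_image_power_eigenunits_moved[OF M] k(1)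
    by (cases "\<sigma> ` M = M") auto
qed

lemma p_le_card_residue_field:
  assumes M: "maximalideal M R"
  shows "p \<le> card (carrier (R Quot M))"
proof -
  obtain f where "0 < f" "card (carrier (R Quot M)) = p ^ f"
    using card_residue_field[OF M] .
  then show ?thesis
    using self_le_power[of p f] prime_gt_0_nat[OF prime_p] by simp
qed

lemma card_maximalideals_le: "card {M. maximalideal M R} \<le> d"
proof -
  have "p ^ card {M. maximalideal M R} = (\<Prod>M | maximalideal M R. p)"
    by simp
  also have "\<dots> \<le> (\<Prod>M | maximalideal M R. card (carrier (R Quot M)))"
  proof (rule prod_mono)
    fix M assume "M \<in> {M. maximalideal M R}"
    then show "0 \<le> p \<and> p \<le> card (carrier (R Quot M))"
      using p_le_card_residue_field by simp
  qed
  also have "\<dots> \<le> p ^ d"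
    using card_quotient_le_if_multiples_p_subset[OF ideal_jacobson_radical]
      card_quotient_jacobson_radical[OF finite_carrier] multiples_p_subset_jacobson_radical by simp
  finally show ?thesis
    using prime_gt_1_nat[OF prime_p] power_le_imp_le_exp by blast
qed

lemma card_Units_ge: "real p ^ (v * d) * (1 - 1 / real p) ^ d \<le> real (card (Units R))"
proof -
  let ?F = "{M. maximalideal M R}"
  have p: "real p > 1"
    using prime_gt_1_nat[OF prime_p] by simp
  have "(1 - 1 / real p) ^ d \<le> (1 - 1 / real p) ^ card ?F"
    using p by (intro power_decreasing card_maximalideals_le) auto
  also have "\<dots> = (\<Prod>M\<in>?F. 1 - 1 / real p)"
    by simp
  also have "\<dots> \<le> (\<Prod>M\<in>?F. 1 - 1 / real (card (carrier (R Quot M))))"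
  proof (rule prod_mono)
    fix M assume "M \<in> ?F"
    then have "real p \<le> real (card (carrier (R Quot M)))"
      using p_le_card_residue_field by simp
    then show "0 \<le> 1 - 1 / real p \<and> 1 - 1 / real p \<le> 1 - 1 / real (card (carrier (R Quot M)))"
      using p by (simp add: frac_le)
  qed
  finally have "real (card (carrier R)) * (1 - 1 / real p) ^ d \<le> real (card (Units R))"
    using card_Units[OF finite_carrier] by (simp add: mult_left_mono)
  then show ?thesis
    by (simp add: card_carrier power_mult)
qed

lemma power_density_le:
  assumes "p dvd k" "k > 1" "\<not> primepow k"
  shows "power_density R \<sigma> k
    \<le> real k * real p powr (real d / 2) / (real p ^ (v * d) * (1 - 1 / real p) ^ d)"
proof -
  have p: "real p > 1"
    using prime_gt_1_nat[OF prime_p] by simp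
  have "real ((card (power_eigenunits R \<sigma> k))\<^sup>2) \<le> real (k\<^sup>2 * p ^ d)"
    using card_power_eigenunits_le[OF assms] by (rule of_nat_mono)
  then have "(real (card (power_eigenunits R \<sigma> k)))\<^sup>2 \<le> (real k * real p powr (real d / 2))\<^sup>2"
    using p by (simp add: power_mult_distrib powr_power powr_realpow)
  then have "real (card (power_eigenunits R \<sigma> k)) \<le> real k * real p powr (real d / 2)"
    by (rule power2_le_imp_le) simp
  then show ?thesis
    unfolding power_density_eq_card_ratio using p card_Units_ge by (intro frac_le) auto
qed

end

lemma (in cyclic_residue_algebra) power_density_le_mod_prime_power:
  assumes p: "prime p" and v: "v \<ge> 1" and "p ^ v dvd n" and k: "p dvd k" "k > 1" "\<not> primepow k"
  shows "power_density R \<sigma> k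
    \<le> real k * real p powr (real d / 2) / (real p ^ (v * d) * (1 - 1 / real p) ^ d)"
proof -
  have "p ^ v > 1"
    using one_less_power[OF prime_gt_1_nat[OF p]] v by simp
  interpret T: cyclic_prime_power_algebra "R Quot multiples (p ^ v)" "(`) \<sigma>" p v d
    by (intro cyclic_prime_power_algebra.intro cyclic_prime_power_algebra_axioms.intro
        cyclic_residue_algebra_quotient \<open>p ^ v dvd n\<close> \<open>p ^ v > 1\<close> p)
  have "power_density R \<sigma> k \<le> power_density (R Quot multiples (p ^ v)) ((`) \<sigma>) k"
    by (rule power_density_le_quotient[OF ideal_multiples multiples_image])
  also note T.power_density_le[OF k]
  finally show ?thesis .
qed

section \<open>Cyclic extensions of residue rings\<close>

lemma generate_fixes:
  assumes \<sigma>: "\<sigma> \<in> Bij C" and x: "x \<in> C" "\<sigma> x = x"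
    and \<tau>: "\<tau> \<in> generate (BijGroup C) {\<sigma>}"
  shows "\<tau> x = x"
proof -
  interpret group "BijGroup C"
    by (rule group_BijGroup)
  have carrier_Bij: "carrier (BijGroup C) = Bij C"
    by (simp add: BijGroup_def)
  show ?thesis
    using \<tau>
  proof (induction rule: generate.induct)
    case one
    show ?case
      using x by (simp add: BijGroup_def)
  next
    case (incl h)
    then show ?case
      using x by simp
  next
    case (inv h)
    have "inj_on \<sigma> C"
      using \<sigma> by (simp add: Bij_def bij_betw_def)
    then have "inv_into C \<sigma> x = x"
      using inv_into_f_f[of \<sigma> C x] x by simp
    then show ?case
      using inv \<sigma> x by (simp add: inv_BijGroup)
  next
    case (eng h1 h2)
    have "h1 \<in> Bij C" "h2 \<in> Bij C"
      using eng.hyps generate_in_carrier[of "{\<sigma>}"] \<sigma> by (auto simp: carrier_Bij)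
    then show ?case
      using eng.IH x by (simp add: BijGroup_def compose_def)
  qed
qed

lemma carrier_residue_ring: "carrier (residue_ring (int n)) = {0..int n - 1}"
  by (simp add: residue_ring_def)

context
  fixes S :: "(int, 's, 'k) module_scheme" and n :: nat
  assumes alg: "Module.algebra (residue_ring (int n)) S" and n: "n > 1"
begin

interpretation S: Module.algebra "residue_ring (int n)" S
  by (rule alg)

lemma add_pow_eq_smult:
  assumes x: "x \<in> carrier S"
  shows "[(k::nat)] \<cdot>\<^bsub>S\<^esub> x = int (k mod n) \<odot>\<^bsub>S\<^esub> x"
proof (induction k)
  case 0
  show ?case using S.smult_l_null[OF x] by (simp add: residue_ring_def)
next
  case (Suc k)
  have "[(Suc k)] \<cdot>\<^bsub>S\<^esub> x = int (k mod n) \<odot>\<^bsub>S\<^esub> x \<oplus>\<^bsub>S\<^esub> \<one>\<^bsub>residue_ring (int n)\<^esub> \<odot>\<^bsub>S\<^esub> x"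
    using Suc x S.smult_one[OF x] by simp
  also have "\<dots> = (int (k mod n) \<oplus>\<^bsub>residue_ring (int n)\<^esub> \<one>\<^bsub>residue_ring (int n)\<^esub>) \<odot>\<^bsub>S\<^esub> x"
    using x n by (intro S.smult_l_distr[symmetric]) (auto simp: residue_ring_def)
  also have "int (k mod n) \<oplus>\<^bsub>residue_ring (int n)\<^esub> \<one>\<^bsub>residue_ring (int n)\<^esub> = int (Suc k mod n)"
    by (simp add: residue_ring_def zmod_int mod_simps add.commute)
  finally show ?case .
qed

lemma smult_eq_add_pow:
  assumes "a \<in> carrier (residue_ring (int n))" "x \<in> carrier S"
  shows "a \<odot>\<^bsub>S\<^esub> x = [(nat a)] \<cdot>\<^bsub>S\<^esub> x"
  using assms add_pow_eq_smult[of x "nat a"] by (simp add: carrier_residue_ring nat_less_iff)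

lemma add_pow_one_eq_zero_iff_if_inj:
  fixes r :: nat
  assumes inj: "inj_on (\<lambda>a. a \<odot>\<^bsub>S\<^esub> \<one>\<^bsub>S\<^esub>) (carrier (residue_ring (int n)))"
  shows "[r] \<cdot>\<^bsub>S\<^esub> \<one>\<^bsub>S\<^esub> = \<zero>\<^bsub>S\<^esub> \<longleftrightarrow> n dvd r"
proof -
  have "[r] \<cdot>\<^bsub>S\<^esub> \<one>\<^bsub>S\<^esub> = \<zero>\<^bsub>S\<^esub> \<longleftrightarrow> int (r mod n) \<odot>\<^bsub>S\<^esub> \<one>\<^bsub>S\<^esub> = 0 \<odot>\<^bsub>S\<^esub> \<one>\<^bsub>S\<^esub>"
    using add_pow_eq_smult[OF S.one_closed, of r] add_pow_eq_smult[OF S.one_closed, of 0] by simp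
  also have "\<dots> \<longleftrightarrow> int (r mod n) = 0"
    using inj_on_eq_iff[OF inj, of "int (r mod n)" 0] n by (simp add: carrier_residue_ring)
  finally show ?thesis
    by (simp add: dvd_eq_mod_eq_0)
qed

lemma free_of_rank_imp_card_and_generated:
  assumes "free_of_rank (residue_ring (int n)) S d"
  shows "card (carrier S) = n ^ d" and "additively_generated S d"
proof -
  let ?F = "{..<d} \<rightarrow>\<^sub>E carrier (residue_ring (int n))"
  obtain b where b: "b \<in> {..<d} \<rightarrow> carrier S"
    and unique: "\<forall>x\<in>carrier S. \<exists>!a. a \<in> ?F \<and> x = (\<Oplus>\<^bsub>S\<^esub>i\<in>{..<d}. a i \<odot>\<^bsub>S\<^esub> b i)"
    using assms unfolding free_of_rank_def by (rule bexE)
  define lc where "lc a = (\<Oplus>\<^bsub>S\<^esub>i\<in>{..<d}. a i \<odot>\<^bsub>S\<^esub> b i)" for a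
  have lc_closed: "lc a \<in> carrier S" if "a \<in> ?F" for a
    unfolding lc_def using that b by (intro S.finsum_closed) (auto simp: Pi_iff PiE_iff)
  have surj: "\<exists>a\<in>?F. x = lc a" if "x \<in> carrier S" for x
    using bspec[OF unique that] unfolding lc_def by blast
  have "bij_betw lc ?F (carrier S)"
  proof (rule bij_betwI')
    show "(lc a = lc a') = (a = a')" if "a \<in> ?F" "a' \<in> ?F" for a a'
      using bspec[OF unique lc_closed[OF that(1)]] that unfolding lc_def by blast
  qed (fact lc_closed surj)+
  then show "card (carrier S) = n ^ d"
    by (simp add: card_PiE carrier_residue_ring flip: bij_betw_same_card)
  show "additively_generated S d"
    unfolding additively_generated_def
  proof (intro bexI[OF _ b] ballI)
    fix x assume "x \<in> carrier S"
    then obtain a where a: "a \<in> ?F" "x = lc a"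
      using surj by blast
    then have "x = (\<Oplus>\<^bsub>S\<^esub>i\<in>{..<d}. [(nat (a i))] \<cdot>\<^bsub>S\<^esub> b i)"
      unfolding a(2) lc_def using b
      by (intro S.finsum_cong') (auto simp: Pi_iff PiE_iff smult_eq_add_pow)
    then show "\<exists>a::nat \<Rightarrow> nat. x = (\<Oplus>\<^bsub>S\<^esub>i\<in>{..<d}. [a i] \<cdot>\<^bsub>S\<^esub> b i)"
      by (rule exI[of _ "\<lambda>i. nat (a i)"])
  qed
qed

end

lemma cyclic_extension_imp_cyclic_residue_algebra:
  fixes S :: "(int, 's, 'k) module_scheme" and n d :: nat
  assumes n: "n > 1" and cyc: "cyclic_extension (residue_ring (int n)) S G"
    and free: "free_of_rank (residue_ring (int n)) S d"
    and \<sigma>: "\<sigma> \<in> G" "generate (BijGroup (carrier S)) {\<sigma>} = G"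
  shows "cyclic_residue_algebra S \<sigma> n d"
proof -
  have alg: "Module.algebra (residue_ring (int n)) S"
    and auts: "G \<subseteq> algebra_auts (residue_ring (int n)) S"
    and inv: "bij_betw (\<lambda>r. r \<odot>\<^bsub>S\<^esub> \<one>\<^bsub>S\<^esub>) (carrier (residue_ring (int n))) (invariants S G)"
    using cyc unfolding cyclic_extension_def galois_extension_def by blast+
  interpret S: Module.algebra "residue_ring (int n)" S
    by (rule alg)
  have Bij: "\<sigma> \<in> Bij (carrier S)" and hom: "\<sigma> \<in> ring_hom S S"
    using \<sigma>(1) auts by (auto simp: algebra_auts_def)
  show ?thesis
  proof
    show "finite (carrier S)"
      using free_of_rank_imp_card_and_generated(1)[OF alg n free] n
      by (intro card_ge_0_finite) simp
    show "\<sigma> \<in> ring_iso S S"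
      using Bij hom by (simp add: ring_iso_def Bij_def)
    show "\<exists>r::nat. x = [r] \<cdot>\<^bsub>S\<^esub> \<one>\<^bsub>S\<^esub>" if x: "x \<in> carrier S" "\<sigma> x = x" for x
    proof -
      have "x \<in> invariants S G"
        using generate_fixes[OF Bij x] x(1) \<sigma>(2) by (auto simp: invariants_def)
      then obtain r where "r \<in> carrier (residue_ring (int n))" "x = r \<odot>\<^bsub>S\<^esub> \<one>\<^bsub>S\<^esub>"
        using inv by (auto simp: bij_betw_def)
      then show ?thesis
        using smult_eq_add_pow[OF alg n] by auto
    qed
    show "[r] \<cdot>\<^bsub>S\<^esub> \<one>\<^bsub>S\<^esub> = \<zero>\<^bsub>S\<^esub> \<longleftrightarrow> n dvd r" for r :: nat
      using bij_betw_imp_inj_on[OF inv] by (rule add_pow_one_eq_zero_iff_if_inj[OF alg n])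
  qed (use n free_of_rank_imp_card_and_generated[OF alg n free] in auto)
qed

section \<open>The density bound\<close>

lemma inverse_one_minus_inverse_le_powr:
  fixes B P :: real
  assumes B: "3 \<le> B" "B \<le> P"
  shows "1 / (1 - 1 / P) \<le> P powr (2 / B)"
proof -
  have "exp 1 \<le> P"
    using exp_le B by linarith
  then have "ln P \<ge> 1"
    using B by (simp add: ln_ge_iff)
  have "1 / (P - 1) \<le> 2 / P"
    using B by (simp add: field_simps)
  also have "\<dots> \<le> 2 / B"
    using B by (intro divide_left_mono) auto
  also have "\<dots> \<le> 2 / B * ln P"
    using \<open>ln P \<ge> 1\<close> B by (simp add: field_simps)
  finally have "exp (1 / (P - 1)) \<le> P powr (2 / B)"
    using B by (simp add: powr_def)
  moreover have "1 / (1 - 1 / P) = 1 + 1 / (P - 1)"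
    using B by (simp add: field_simps)
  ultimately show ?thesis
    using exp_ge_add_one_self[of "1 / (P - 1)"] by linarith
qed

lemma residue_bound_le_powr:
  fixes A B P N :: real and d v :: nat
  assumes B: "3 \<le> B" "B \<le> P" and v: "v \<ge> 1" and N: "0 \<le> N" "N \<le> P powr (real v * real d / A)"
  shows "N * P powr (real d / 2) / (P ^ (v * d) * (1 - 1 / P) ^ d)
    \<le> P powr (- (real v * real d / 2) * (1 - 2 / A - 4 / B))"
proof -
  have P: "P > 1"
    using B by simp
  have dv: "real d \<le> real v * real d"
    using v mult_right_mono[of 1 "real v" "real d"] by simp
  have "(1 / (1 - 1 / P)) ^ d \<le> (P powr (2 / B)) ^ d"
    using inverse_one_minus_inverse_le_powr[OF B] P by (intro power_mono) auto
  also have "\<dots> = P powr (2 / B * real d)"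
    using P by (simp add: powr_powr flip: powr_realpow)
  also have "\<dots> \<le> P powr (2 / B * (real v * real d))"
    using P B dv by (intro powr_mono mult_left_mono) auto
  finally have units: "(1 / (1 - 1 / P)) ^ d \<le> P powr (2 / B * (real v * real d))" .
  have residue: "P powr (real d / 2) \<le> P powr (real v * real d / 2)"
    using P dv by (intro powr_mono) auto
  have "N * P powr (real d / 2) / (P ^ (v * d) * (1 - 1 / P) ^ d)
      = N * P powr (real d / 2) * P powr (- (real v * real d)) * (1 / (1 - 1 / P)) ^ d"
    using P by (simp add: powr_minus_divide power_divide flip: powr_realpow)
  also have "\<dots> \<le> P powr (real v * real d / A) * P powr (real v * real d / 2)
      * P powr (- (real v * real d)) * P powr (2 / B * (real v * real d))"
    using N units residue P by (intro mult_mono mult_nonneg_nonneg) auto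
  also have "\<dots> = P powr (real v * real d / A + real v * real d / 2
      + - (real v * real d) + 2 / B * (real v * real d))"
    by (simp only: powr_add)
  also have "real v * real d / A + real v * real d / 2 + - (real v * real d)
        + 2 / B * (real v * real d)
      = - (real v * real d / 2) * (1 - 2 / A - 4 / B)"
    by (simp add: algebra_simps)
  finally show ?thesis .
qed

lemma powr_neg_le_powr_neg:
  fixes A P N c e :: real
  assumes "A > 0" "c \<ge> 0" "N > 0" and N: "N \<le> P powr (e / A)"
  shows "P powr (- (e / 2) * c) \<le> N powr (- (A / 2) * c)"
proof -
  have "(P powr (e / A)) powr (- (A / 2) * c) \<le> N powr (- (A / 2) * c)"
    using assms by (intro powr_mono2') auto
  then show ?thesis
    using \<open>A > 0\<close> by (simp add: powr_powr)
qed

theorem theorem3: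
  fixes A B :: real
    and n d p v :: nat
    and S :: "(int, 's, 'k) module_scheme"
    and G :: "('s \<Rightarrow> 's) set"
    and \<sigma> :: "'s \<Rightarrow> 's"
  assumes "A > 2" and "B \<ge> 3"
    and "n \<ge> 3"
    and "\<And>q. prime q \<Longrightarrow> q dvd n \<Longrightarrow> real q \<ge> B"
    and "\<not> primepow n"
    and "cyclic_extension (residue_ring (int n)) S G"
    and "free_of_rank (residue_ring (int n)) S d"
    and "\<sigma> \<in> G" and "generate (BijGroup (carrier S)) {\<sigma>} = G"
    and "prime p" and "v \<ge> 1" and "p ^ v dvd n"
    and "real v * ln (real p) \<ge> A * ln (real n) / real d"
  shows "power_density S \<sigma> n
           \<le> real p powr (- (real v * real d / 2) * (1 - 2 / A - 4 / B)) \<and>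
         (0 \<le> 1 - 2 / A - 4 / B \<longrightarrow>
           real p powr (- (real v * real d / 2) * (1 - 2 / A - 4 / B))
           \<le> real n powr (- (A / 2) * (1 - 2 / A - 4 / B))) \<and>
         power_density S \<sigma> n
           \<le> real n powr (- (A / 2) * (1 - 2 / A - 4 / B))"
proof -
  interpret S: cyclic_residue_algebra S \<sigma> n d
    using assms(3,6-9) by (intro cyclic_extension_imp_cyclic_residue_algebra) auto
  define c where "c = 1 - 2 / A - 4 / B"
  have "p dvd n"
    using dvd_trans[OF dvd_power assms(12)] assms(11) by simp
  then have "B \<le> real p"
    using assms(4,10) by blast
  have n_le: "real n \<le> real p powr (real v * real d / A)"
    using assms(1,3,13) S.dim_pos prime_gt_1_nat[OF assms(10)]
    by (simp add: log_le_iff[symmetric] log_def field_simps)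
  have bound_p: "power_density S \<sigma> n \<le> real p powr (- (real v * real d / 2) * c)"
    using S.power_density_le_mod_prime_power[OF assms(10-12) \<open>p dvd n\<close> S.n_gt_one assms(5)]
      residue_bound_le_powr[OF assms(2) \<open>B \<le> real p\<close> assms(11) _ n_le] unfolding c_def by simp
  have bound_n: "real p powr (- (real v * real d / 2) * c) \<le> real n powr (- (A / 2) * c)"
    if "0 \<le> c"
    using assms(1,3) that n_le by (intro powr_neg_le_powr_neg) auto
  have "power_density S \<sigma> n \<le> real n powr (- (A / 2) * c)"
  proof (cases "0 \<le> c")
    case False
    then have "1 \<le> real n powr (- (A / 2) * c)"
      using assms(1,3) by (intro ge_one_powr_ge_zero) (auto simp: mult_nonneg_nonpos)
    then show ?thesis
      using S.power_density_le_one[of n] by linarith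
  qed (use bound_p bound_n in linarith)
  then show ?thesis
    using bound_p bound_n unfolding c_def by blast
qed

end
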